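(* Let $(R,\mathfrak m)$ be an $F$-finite noetherian local domain of characteristic $p>0$ and dimension $d$, and let $(x_1,\dots,x_d)$ be a full system of parameters of $R$. For an integer $0\le r\le d$, set $I=(x_1,\dots,x_r)$ and $J=(x_{r+1},\dots,x_d)$, with the understanding that $I=0$ when $r=0$. Then for any $s\in\mathbb R_{>0}$, $$h_{I,J}(s)=\frac{e(I+J,R)}{r!}\,s^r.$$
   Context: $F$-finite means the Frobenius endomorphism is finite. $e(-,R)$ is the Hilbert–Samuel multiplicity. The $h$-function is $h_{I,J}(s)=\lim_{n\to\infty}\frac1{p^{nd}}l\big(R/(I^{\lceil sp^n\rceil}+J^{[p^n]})\big)$ for $s\in\mathbb R$, where $l$ is length, $J^{[p^n]}$ is the ideal generated by $p^n$-th powers of elements of $J$, and nonpositive powers of $I$ are the unit ideal; the limit exists for all $s$. When $r=d$, $J$ is the zero ideal. *)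

theory Defs
  imports Complex_Main "HOL-Algebra.Algebra" "HOL-Library.Extended_Nat"
begin

definition local_ring :: "('a, 'b) ring_scheme \<Rightarrow> 'a set \<Rightarrow> bool" where
  "local_ring R m \<longleftrightarrow> cring R \<and> {M. maximalideal M R} = {m}"

text \<open>As for the type-class constant CHAR, \<open>p = 0\<close> is characteristic zero.\<close>

definition has_char :: "('a, 'b) ring_scheme \<Rightarrow> nat \<Rightarrow> bool" where
  "has_char R p \<longleftrightarrow> (\<forall>n::nat. [n] \<cdot>\<^bsub>R\<^esub> \<one>\<^bsub>R\<^esub> = \<zero>\<^bsub>R\<^esub> \<longleftrightarrow> p dvd n)"

text \<open>A map \<open>f\<close> (meant to be a ring homomorphism) is finite if \<open>B\<close> is finitely generated as
  an \<open>A\<close>-module via \<open>f\<close>.\<close>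

definition finite_ring_map ::
  "('a, 'c) ring_scheme \<Rightarrow> ('b, 'd) ring_scheme \<Rightarrow> ('a \<Rightarrow> 'b) \<Rightarrow> bool" where
  "finite_ring_map A B f \<longleftrightarrow>
     (\<exists>S. finite S \<and> S \<subseteq> carrier B \<and>
       (\<forall>b \<in> carrier B. \<exists>c \<in> S \<rightarrow> carrier A. b = (\<Oplus>\<^bsub>B\<^esub>s\<in>S. f (c s) \<otimes>\<^bsub>B\<^esub> s)))"

definition F_finite :: "('a, 'b) ring_scheme \<Rightarrow> nat \<Rightarrow> bool" where
  "F_finite R p \<longleftrightarrow> finite_ring_map R R (\<lambda>a. a [^]\<^bsub>R\<^esub> p)"

definition krull_dim :: "('a, 'b) ring_scheme \<Rightarrow> enat" where
  "krull_dim R =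
     (SUP n \<in> {n. \<exists>P. (\<forall>i\<le>n. primeideal (P i) R) \<and> (\<forall>i<n. P i \<subset> P (Suc i))}. enat n)"

definition ideal_radical :: "('a, 'b) ring_scheme \<Rightarrow> 'a set \<Rightarrow> 'a set" where
  "ideal_radical R I = {a \<in> carrier R. \<exists>n::nat. a [^]\<^bsub>R\<^esub> n \<in> I}"

text \<open>A full system of parameters \<open>x 1, \<dots>, x d\<close> of a local ring with maximal ideal \<open>m\<close>;
  since \<open>m\<close> is maximal, radical \<open>m\<close> means that the generated ideal is \<open>m\<close>-primary.\<close>

definition system_of_parameters ::
  "('a, 'b) ring_scheme \<Rightarrow> 'a set \<Rightarrow> nat \<Rightarrow> (nat \<Rightarrow> 'a) \<Rightarrow> bool" where
  "system_of_parameters R m d x \<longleftrightarrow>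
     krull_dim R = enat d \<and> x ` {1..d} \<subseteq> m \<and> ideal_radical R (Idl\<^bsub>R\<^esub> (x ` {1..d})) = m"

definition module_length :: "('a, 'c) ring_scheme \<Rightarrow> ('a, 'b, 'd) module_scheme \<Rightarrow> enat" where
  "module_length R M =
     (SUP n \<in> {n. \<exists>N. (\<forall>i\<le>n. submodule (N i) R M) \<and> (\<forall>i<n. N i \<subset> N (Suc i))}. enat n)"

text \<open>The cyclic \<open>R\<close>-module \<open>R/I\<close>: the additive group of the quotient ring, on which
  \<open>a\<close> acts as multiplication by its residue class.\<close>

definition quot_module :: "('a, 'b) ring_scheme \<Rightarrow> 'a set \<Rightarrow> ('a, 'a set) module" where
  "quot_module R I =
     ring.extend (R Quot I) (module.fields (\<lambda>a C. (I +>\<^bsub>R\<^esub> a) \<otimes>\<^bsub>R Quot I\<^esub> C))"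

text \<open>The length of \<open>R/I\<close> as a real number; meaningful only when that length is finite, which
  is the case for the ideals \<open>I\<close> occurring below.\<close>

definition colength :: "('a, 'b) ring_scheme \<Rightarrow> 'a set \<Rightarrow> real" where
  "colength R I = real (the_enat (module_length R (quot_module R I)))"

text \<open>Powers of an ideal are taken in the library's semiring of ideals, so that the
  zeroth power is the unit ideal.\<close>

abbreviation ideal_power :: "('a, 'b) ring_scheme \<Rightarrow> 'a set \<Rightarrow> nat \<Rightarrow> 'a set" where
  "ideal_power R I n \<equiv> I [^]\<^bsub>ideals_set R\<^esub> n"

definition frobenius_power :: "('a, 'b) ring_scheme \<Rightarrow> 'a set \<Rightarrow> nat \<Rightarrow> 'a set" where
  "frobenius_power R J q = Idl\<^bsub>R\<^esub> {a [^]\<^bsub>R\<^esub> q | a. a \<in> J}"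

text \<open>The multiplicity \<open>e(I, R)\<close> of an ideal primary to the maximal ideal.\<close>

definition hilbert_samuel_mult :: "('a, 'b) ring_scheme \<Rightarrow> 'a set \<Rightarrow> real" where
  "hilbert_samuel_mult R I =
     (let d = the_enat (krull_dim R)
      in lim (\<lambda>n. fact d * colength R (ideal_power R I n) / real n ^ d))"

text \<open>\<open>nat\<close> sends negative exponents to \<open>0\<close>, so nonpositive powers of \<open>I\<close> are the unit ideal.\<close>

definition h_function ::
  "('a, 'b) ring_scheme \<Rightarrow> nat \<Rightarrow> 'a set \<Rightarrow> 'a set \<Rightarrow> real \<Rightarrow> real" where
  "h_function R p I J s =
     (let d = the_enat (krull_dim R)
      in lim (\<lambda>n. colength R
            (ideal_power R I (nat \<lceil>s * real (p ^ n)\<rceil>) <+>\<^bsub>R\<^esub> frobenius_power R J (p ^ n))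
          / real (p ^ (n * d))))"

end

theory Submission
  imports Defs
begin

text \<open>
  Put \<open>L = {1..d}\<close>. Both \<open>I\<^sup>t + J\<^bsup>[q]\<^esup>\<close> and \<open>(I + J)\<^sup>n\<close> are generated by monomials in the
  parameters, so it suffices to compare the colength of such an ideal with the number of exponents
  outside it. Adjoining one monomial \<open>x\<^sup>u\<close>, for \<open>u\<close> maximal among the missing exponents, changes
  the ideal by a cyclic module killed by all parameters. Applied to the powers \<open>x\<^sub>i\<^sup>k\<close>, this bounds
  every colength by \<open>F k\<close> times a number of boxes of side \<open>k\<close>, where \<open>F k\<close> is the colength of
  \<open>(x\<^sub>1\<^sup>k, \<dots>, x\<^sub>d\<^sup>k)\<close>. In particular \<open>F k / k\<^sup>d\<close> tends to its infimum \<open>c\<close>. Applying the bound to an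
  exponent region, and also to its complement in a large box, where the total \<open>F\<close> is at
  least \<open>c\<close> times the volume, shows that the colength is asymptotically \<open>c\<close> times the volume of the
  region. The volume is \<open>1 / d!\<close> for \<open>(I + J)\<^sup>n\<close>, which gives \<open>c = e(I + J)\<close>, and \<open>s\<^sup>r / r!\<close> for
  \<open>I\<^sup>t + J\<^bsup>[q]\<^esup>\<close>. Koszul homology and Hilbert polynomials are not needed.
\<close>

section \<open>Lengths of chains and of modules\<close>

text \<open>Bounding chains through a strictly increasing labelling makes subadditivity of length a matter
  of adding labellings.\<close>

definition chain_bound :: "'a::order set \<Rightarrow> nat \<Rightarrow> bool" where
  "chain_bound S k \<longleftrightarrow>
     (\<exists>\<rho>. (\<forall>V\<in>S. \<rho> V \<le> k) \<and> (\<forall>V\<in>S. \<forall>Y\<in>S. V < Y \<longrightarrow> \<rho> V < \<rho> Y))"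

lemma chain_boundI:
  assumes "\<And>V. V \<in> S \<Longrightarrow> \<rho> V \<le> k" "\<And>V Y. V \<in> S \<Longrightarrow> Y \<in> S \<Longrightarrow> V < Y \<Longrightarrow> \<rho> V < \<rho> Y"
  shows "chain_bound S k"
  using assms unfolding chain_bound_def by blast

lemma chain_boundE:
  assumes "chain_bound S k"
  obtains \<rho> where "\<And>V. V \<in> S \<Longrightarrow> \<rho> V \<le> k"
    and "\<And>V Y. V \<in> S \<Longrightarrow> Y \<in> S \<Longrightarrow> V < Y \<Longrightarrow> \<rho> V < \<rho> Y"
  using assms unfolding chain_bound_def by blast

lemma chain_bound_subset: "chain_bound S k \<Longrightarrow> T \<subseteq> S \<Longrightarrow> chain_bound T k"
  unfolding chain_bound_def by (meson subsetD)

text \<open>Composing a labelling of \<open>T\<close> with \<open>f\<close> labels \<open>S\<close>.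
  It serves for the residue map in both directions and for the passage from an ideal to its colon by
  a fixed element.\<close>

lemma chain_bound_strict_image:
  assumes "chain_bound T k" "\<And>V. V \<in> S \<Longrightarrow> f V \<in> T"
    and "\<And>V Y. V \<in> S \<Longrightarrow> Y \<in> S \<Longrightarrow> V < Y \<Longrightarrow> f V < f Y"
  shows "chain_bound S k"
proof -
  obtain \<rho> where "\<And>V. V \<in> T \<Longrightarrow> \<rho> V \<le> k" "\<And>V Y. V \<in> T \<Longrightarrow> Y \<in> T \<Longrightarrow> V < Y \<Longrightarrow> \<rho> V < \<rho> Y"
    using chain_boundE[OF assms(1)] by metis
  then show ?thesis
    using assms(2,3) by (intro chain_boundI[where \<rho> = "\<rho> \<circ> f"]) auto
qed

text \<open>The sum of the two labellings works: along \<open>V < Y\<close> neither label drops, and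
  the last premise says that the two images cannot both stand still. For ideals, \<open>f\<close>
  will be the sum with a fixed ideal and \<open>g\<close> the intersection with it.\<close>

lemma chain_bound_add:
  assumes "chain_bound T k" "chain_bound U l"
    and "\<And>V. V \<in> S \<Longrightarrow> f V \<in> T" "\<And>V. V \<in> S \<Longrightarrow> g V \<in> U"
    and "\<And>V Y. V \<in> S \<Longrightarrow> Y \<in> S \<Longrightarrow> V < Y \<Longrightarrow> f V \<le> f Y"
    and "\<And>V Y. V \<in> S \<Longrightarrow> Y \<in> S \<Longrightarrow> V < Y \<Longrightarrow> g V \<le> g Y"
    and "\<And>V Y. V \<in> S \<Longrightarrow> Y \<in> S \<Longrightarrow> V < Y \<Longrightarrow> f V = f Y \<Longrightarrow> g V = g Y \<Longrightarrow> False"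
  shows "chain_bound S (k + l)"
proof -
  obtain \<rho> where \<rho>: "\<And>V. V \<in> T \<Longrightarrow> \<rho> V \<le> k" "\<And>V Y. V \<in> T \<Longrightarrow> Y \<in> T \<Longrightarrow> V < Y \<Longrightarrow> \<rho> V < \<rho> Y"
    using chain_boundE[OF assms(1)] by metis
  obtain \<sigma> where \<sigma>: "\<And>V. V \<in> U \<Longrightarrow> \<sigma> V \<le> l" "\<And>V Y. V \<in> U \<Longrightarrow> Y \<in> U \<Longrightarrow> V < Y \<Longrightarrow> \<sigma> V < \<sigma> Y"
    using chain_boundE[OF assms(2)] by metis
  show ?thesis
  proof (rule chain_boundI[where \<rho> = "\<lambda>V. \<rho> (f V) + \<sigma> (g V)"])
    fix V assume "V \<in> S"
    then show "\<rho> (f V) + \<sigma> (g V) \<le> k + l"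
      using \<rho>(1) \<sigma>(1) assms(3,4) by (simp add: add_mono)
  next
    fix V Y assume XY: "V \<in> S" "Y \<in> S" "V < Y"
    have "\<rho> (f V) < \<rho> (f Y) \<or> f V = f Y" "\<sigma> (g V) < \<sigma> (g Y) \<or> g V = g Y"
      using XY assms(3-6) \<rho>(2) \<sigma>(2) by (meson order_less_le)+
    then show "\<rho> (f V) + \<sigma> (g V) < \<rho> (f Y) + \<sigma> (g Y)"
      using assms(7)[OF XY] by auto
  qed
qed

text \<open>Labels rise by at least one at each step of the chain, so the label of
  \<open>N i\<close> is at least \<open>i\<close>.\<close>

lemma chain_bound_chain:
  assumes "chain_bound S k" "\<forall>i\<le>n. N i \<in> S" "\<forall>i<n. N i < N (Suc i)"
  shows "n \<le> k"
proof -
  obtain \<rho> where \<rho>: "\<And>V. V \<in> S \<Longrightarrow> \<rho> V \<le> k" "\<And>V Y. V \<in> S \<Longrightarrow> Y \<in> S \<Longrightarrow> V < Y \<Longrightarrow> \<rho> V < \<rho> Y"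
    using chain_boundE[OF assms(1)] by metis
  have "i \<le> \<rho> (N i)" if "i \<le> n" for i
    using that
  proof (induction i)
    case (Suc i)
    then have "\<rho> (N i) < \<rho> (N (Suc i))" using assms(2,3) \<rho>(2) by simp
    then show ?case using Suc by simp
  qed simp
  then have "n \<le> \<rho> (N n)" by simp
  then show ?thesis using \<rho>(1)[of "N n"] assms(2) by simp
qed

text \<open>The rank of \<open>V\<close> is the length of the longest chain in \<open>S\<close> that ends in \<open>V\<close>.\<close>

lemma chain_bound_iff:
  "chain_bound S k \<longleftrightarrow> (\<forall>n N. (\<forall>i\<le>n. N i \<in> S) \<and> (\<forall>i<n. N i < N (Suc i)) \<longrightarrow> n \<le> k)"
    (is "_ \<longleftrightarrow> ?R")
proof
  assume ?R
  define C where "C V = {n. \<exists>N. (\<forall>i\<le>n. N i \<in> S) \<and> (\<forall>i<n. N i < N (Suc i)) \<and> N n = V}" for V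
  have bd: "n \<le> k" if "n \<in> C V" for n V
    using that \<open>?R\<close> unfolding C_def by blast
  then have fin: "finite (C V)" for V
    by (meson atMost_iff finite_atMost finite_subset subsetI)
  have ne: "C V \<noteq> {}" if "V \<in> S" for V
  proof -
    have "0 \<in> C V" using that unfolding C_def by (auto intro!: exI[of _ "\<lambda>_. V"])
    then show ?thesis by blast
  qed
  show "chain_bound S k"
  proof (rule chain_boundI[where \<rho> = "\<lambda>V. Max (C V)"])
    fix V assume "V \<in> S" then show "Max (C V) \<le> k" using bd fin ne by simp
  next
    fix V Y assume XY: "V \<in> S" "Y \<in> S" "V < Y"
    have "Max (C V) \<in> C V" using fin ne XY by simp
    then obtain N where N: "\<forall>i\<le>Max (C V). N i \<in> S" "\<forall>i<Max (C V). N i < N (Suc i)"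
      "N (Max (C V)) = V"
      unfolding C_def by blast
    define k where "k = Max (C V)"
    have "(\<forall>i\<le>Suc k. (N(Suc k := Y)) i \<in> S) \<and> (\<forall>i<Suc k. (N(Suc k := Y)) i < (N(Suc k := Y)) (Suc i))"
      using N XY unfolding k_def[symmetric] by (auto simp: less_Suc_eq le_Suc_eq)
    moreover have "(N(Suc k := Y)) (Suc k) = Y" by simp
    ultimately have "Suc k \<in> C Y"
      unfolding C_def by blast
    then have "Suc (Max (C V)) \<in> C Y" by (simp add: k_def)
    then show "Max (C V) < Max (C Y)" using fin by (simp add: Max_ge Suc_le_lessD)
  qed
qed (use chain_bound_chain in blast)

section \<open>From module length to chains of ideals\<close>

lemma module_length_le_iff:
  "module_length R M \<le> enat k \<longleftrightarrow> chain_bound {N. submodule N R M} k"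
  unfolding module_length_def chain_bound_iff by (auto simp: SUP_le_iff)

text \<open>For ideals \<open>I\<close> inside \<open>K\<close> this stands for the submodules of
  \<open>K/I\<close>: a \<open>chain_bound\<close> on it bounds the length of \<open>K/I\<close>
  while everything stays inside \<open>R\<close>.\<close>

definition ideal_interval :: "('a, 'b) ring_scheme \<Rightarrow> 'a set \<Rightarrow> 'a set \<Rightarrow> 'a set set" where
  "ideal_interval R I K = {N. ideal N R \<and> I \<subseteq> N \<and> N \<subseteq> K}"

lemma ideal_intervalD:
  "N \<in> ideal_interval R I K \<Longrightarrow> ideal N R \<and> I \<subseteq> N \<and> N \<subseteq> K"
  unfolding ideal_interval_def by blast

context cring
begin

lemma quot_module_simps:
  "carrier (quot_module R I) = carrier (R Quot I)"
  "add (quot_module R I) = add (R Quot I)"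
  "ring.zero (quot_module R I) = ring.zero (R Quot I)"
  "smult (quot_module R I) = (\<lambda>a C. (I +> a) \<otimes>\<^bsub>R Quot I\<^esub> C)"
  by (simp_all add: quot_module_def FactRing_def ring.defs module.defs)

text \<open>Scalars act through their residue classes, and every element of the quotient ring is
  such a class; closure under scalars is therefore the absorption property of an ideal.\<close>

lemma submodule_quot_iff_ideal:
  assumes "ideal I R"
  shows "submodule H R (quot_module R I) \<longleftrightarrow> ideal H (R Quot I)"
proof -
  interpret I: ideal I R by fact
  have cr: "cring (R Quot I)" using I.quotient_is_cring[OF is_cring] .
  interpret Q: cring "R Quot I" by fact
  have sg: "subgroup H (add_monoid (quot_module R I)) \<longleftrightarrow> subgroup H (add_monoid (R Quot I))"
    unfolding subgroup_def m_inv_def by (simp add: quot_module_simps(1-3))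
  have car: "carrier (R Quot I) = (\<lambda>a. I +> a) ` carrier R"
    unfolding FactRing_def A_RCOSETS_def' by auto
  show ?thesis
  proof
    assume "submodule H R (quot_module R I)"
    then interpret H: submodule H R "quot_module R I" .
    have H: "subgroup H (add_monoid (R Quot I))"
      unfolding sg[symmetric] by (rule H.subgroup_axioms)
    have 1: "C \<otimes>\<^bsub>R Quot I\<^esub> h \<in> H" if h: "h \<in> H" and C: "C \<in> carrier (R Quot I)" for h C
    proof -
      obtain a where "a \<in> carrier R" "C = I +> a" using C unfolding car by (rule imageE)
      then show ?thesis using H.smult_closed[of a h] h unfolding quot_module_simps by simp
    qed
    have 2: "h \<otimes>\<^bsub>R Quot I\<^esub> C \<in> H" if "h \<in> H" "C \<in> carrier (R Quot I)" for h C
      using 1[OF that] Q.m_comm[OF _ that(2), of h] subgroup.subset[OF H] that(1) by auto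
    show "ideal H (R Quot I)" by (rule idealI[OF Q.ring_axioms H 1 2])
  next
    assume "ideal H (R Quot I)"
    then interpret H: ideal H "R Quot I" .
    have "subgroup H (add_monoid (quot_module R I))"
      unfolding sg by (rule H.a_subgroup)
    moreover have "a \<odot>\<^bsub>quot_module R I\<^esub> h \<in> H" if "a \<in> carrier R" "h \<in> H" for a h
      unfolding quot_module_simps
      by (rule H.I_l_closed[OF that(2)]) (use that(1) in \<open>simp add: car\<close>)
    ultimately show "submodule H R (quot_module R I)"
      by (intro submodule.intro submodule_axioms.intro)
  qed
qed

lemma quot_ideal_preimage:
  assumes "ideal I R" "ideal H (R Quot I)"
  shows "ideal {a \<in> carrier R. I +> a \<in> H} R" "I \<subseteq> {a \<in> carrier R. I +> a \<in> H}"
proof -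
  interpret I: ideal I R by fact
  interpret H: ideal H "R Quot I" by fact
  interpret h: ring_hom_ring R "R Quot I" "(+>) I" by (rule I.rcos_ring_hom_ring)
  note H_sub = H.additive_subgroup_axioms
  let ?N = "{a \<in> carrier R. I +> a \<in> H}"
  have N: "a \<in> ?N \<longleftrightarrow> a \<in> carrier R \<and> I +> a \<in> H" for a by simp
  have zero: "I +> \<zero> \<in> H" unfolding h.hom_zero by (rule additive_subgroup.zero_closed[OF H_sub])
  show "ideal ?N R"
  proof (rule idealI)
    show "ring R" by (rule ring_axioms)
    show "subgroup ?N (add_monoid R)"
    proof (rule add.subgroupI)
      show "?N \<noteq> {}" using zero by (metis (no_types) N empty_iff zero_closed)
      show "\<ominus> a \<in> ?N" if "a \<in> ?N" for a
        using that h.hom_a_inv[of a] additive_subgroup.a_inv_closed[OF H_sub, of "I +> a"]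
        unfolding N by simp
      show "a \<oplus> b \<in> ?N" if "a \<in> ?N" "b \<in> ?N" for a b
        using that h.hom_add[of a b] additive_subgroup.a_closed[OF H_sub, of "I +> a" "I +> b"] unfolding N by simp
    qed simp
    show "b \<otimes> a \<in> ?N" if "a \<in> ?N" "b \<in> carrier R" for a b
      using that h.hom_mult[of b a] H.I_l_closed[of "I +> a" "I +> b"] h.hom_closed[of b]
      unfolding N by simp
    show "a \<otimes> b \<in> ?N" if "a \<in> ?N" "b \<in> carrier R" for a b
      using that h.hom_mult[of a b] H.I_r_closed[of "I +> a" "I +> b"] h.hom_closed[of b]
      unfolding N by simp
  qed
  show "I \<subseteq> ?N"
  proof
    fix a assume a: "a \<in> I"
    have "I +> a = I +> \<zero>" using I.a_rcos_const[OF a] I.a_rcos_const[OF I.zero_closed] by simp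
    then show "a \<in> ?N" using zero I.Icarr[OF a] unfolding N by simp
  qed
qed

lemma ideal_image_quot:
  assumes "ideal I R" "ideal N R"
  shows "ideal ((\<lambda>a. I +> a) ` N) (R Quot I)"
proof -
  interpret I: ideal I R by fact
  interpret h: ring_hom_ring R "R Quot I" "(+>) I" by (rule I.rcos_ring_hom_ring)
  interpret N: ideal N R by fact
  have car: "carrier (R Quot I) = (\<lambda>a. I +> a) ` carrier R"
    unfolding FactRing_def A_RCOSETS_def' by auto
  let ?f = "(\<lambda>a. I +> a)"
  show ?thesis
  proof (rule idealI)
    show "ring (R Quot I)" by (rule h.S.ring_axioms)
    show "subgroup (?f ` N) (add_monoid (R Quot I))"
    proof (rule h.S.add.subgroupI)
      show "?f ` N \<subseteq> carrier (R Quot I)" unfolding car using N.a_subset by (rule image_mono)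
      show "?f ` N \<noteq> {}" using N.zero_closed by (metis (no_types) empty_iff image_eqI)
      fix C assume "C \<in> ?f ` N"
      then obtain a where a: "a \<in> N" "C = ?f a" by (elim imageE)
      have "\<ominus>\<^bsub>R Quot I\<^esub> C = ?f (\<ominus> a)" using h.hom_a_inv[of a] N.Icarr[of a] a by simp
      then show "\<ominus>\<^bsub>R Quot I\<^esub> C \<in> ?f ` N"
        using N.a_inv_closed[OF a(1)] by (rule image_eqI)
      fix D assume "D \<in> ?f ` N"
      then obtain b where b: "b \<in> N" "D = ?f b" by (elim imageE)
      have "C \<oplus>\<^bsub>R Quot I\<^esub> D = ?f (a \<oplus> b)"
        using h.hom_add[of a b] N.Icarr[of a] N.Icarr[of b] a b by simp
      then show "C \<oplus>\<^bsub>R Quot I\<^esub> D \<in> ?f ` N"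
        using N.a_closed[OF a(1) b(1)] by (rule image_eqI)
    qed
    fix C D assume "C \<in> ?f ` N" "D \<in> carrier (R Quot I)"
    then obtain a b where a: "a \<in> N" "C = ?f a" and b: "b \<in> carrier R" "D = ?f b"
      unfolding car by (elim imageE)
    have "D \<otimes>\<^bsub>R Quot I\<^esub> C = ?f (b \<otimes> a)" "C \<otimes>\<^bsub>R Quot I\<^esub> D = ?f (a \<otimes> b)"
      using h.hom_mult[of a b] h.hom_mult[of b a] N.Icarr[of a] a b by simp_all
    then show "D \<otimes>\<^bsub>R Quot I\<^esub> C \<in> ?f ` N" "C \<otimes>\<^bsub>R Quot I\<^esub> D \<in> ?f ` N"
      using N.I_l_closed[OF a(1) b(1)] N.I_r_closed[OF a(1) b(1)] by (simp_all only: imageI)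
  qed
qed

text \<open>An ideal above \<open>I\<close> is a union of cosets of \<open>I\<close>. Hence passing
  to images in the quotient preserves strict inclusions between such ideals.\<close>

lemma rcos_image_mem_iff:
  assumes "ideal I R" "ideal N R" "I \<subseteq> N" "a \<in> carrier R"
  shows "I +> a \<in> (\<lambda>a. I +> a) ` N \<longleftrightarrow> a \<in> N"
proof
  interpret I: ideal I R by fact
  interpret N: ideal N R by fact
  assume "I +> a \<in> (\<lambda>a. I +> a) ` N"
  then obtain b where b: "b \<in> N" "I +> a = I +> b" by (elim imageE)
  then have "a \<in> I +> b" using I.a_rcos_self[OF assms(4)] by simp
  then obtain i where "i \<in> I" "a = i \<oplus> b" unfolding a_r_coset_def' by auto
  then show "a \<in> N" using N.a_closed[of i b] b(1) subsetD[OF assms(3)] by simp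
qed (rule imageI)

text \<open>Image and preimage under the residue map are strictly increasing between the ideals
  above \<open>I\<close> and the ideals of the quotient, and each of the two maps transports the
  bound in one direction.\<close>

lemma quot_module_length_le_iff:
  assumes I: "ideal I R"
  shows "module_length R (quot_module R I) \<le> enat k
    \<longleftrightarrow> chain_bound (ideal_interval R I (carrier R)) k"
proof -
  let ?f = "\<lambda>N. (\<lambda>a. I +> a) ` N" and ?g = "\<lambda>H. {a \<in> carrier R. I +> a \<in> H}"
  have car: "carrier (R Quot I) = (\<lambda>a. I +> a) ` carrier R"
    by (auto simp: FactRing_def A_RCOSETS_def')
  have f: "ideal (?f N) (R Quot I)" if "N \<in> ideal_interval R I (carrier R)" for N
    using ideal_image_quot[OF I] that unfolding ideal_interval_def by blast
  have fs: "?f N < ?f N'" if N: "N \<in> ideal_interval R I (carrier R)"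
    "N' \<in> ideal_interval R I (carrier R)" "N < N'" for N N'
  proof -
    have id: "ideal N R" "I \<subseteq> N" using ideal_intervalD[OF N(1)] by simp_all
    obtain a where a: "a \<in> N'" "a \<notin> N" using N(3) by auto
    have "a \<in> carrier R" using a ideal_intervalD[OF N(2)] by auto
    then have "I +> a \<notin> ?f N" using rcos_image_mem_iff[OF I id] a by simp
    moreover have "I +> a \<in> ?f N'" using a(1) by (rule imageI)
    moreover have "?f N \<subseteq> ?f N'" using N(3) by (intro image_mono) simp
    ultimately show ?thesis unfolding less_le by metis
  qed
  have g: "?g H \<in> ideal_interval R I (carrier R)" if "ideal H (R Quot I)" for H
    using quot_ideal_preimage[OF I that] unfolding ideal_interval_def by blast
  have gs: "?g H < ?g H'" if H: "ideal H (R Quot I)" "ideal H' (R Quot I)" "H < H'" for H H'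
  proof -
    obtain C where C: "C \<in> H'" "C \<notin> H" using H(3) by blast
    then have "C \<in> carrier (R Quot I)" using ideal.Icarr[OF H(2)] by simp
    then obtain a where a: "a \<in> carrier R" "C = I +> a" unfolding car by (elim imageE)
    have "a \<in> ?g H'" "a \<notin> ?g H" using a C by simp_all
    moreover have "?g H \<subseteq> ?g H'" using H(3) by auto
    ultimately show ?thesis unfolding less_le by metis
  qed
  show ?thesis
    unfolding module_length_le_iff submodule_quot_iff_ideal[OF I]
  proof
    assume "chain_bound {N. ideal N (R Quot I)} k"
    then show "chain_bound (ideal_interval R I (carrier R)) k"
      by (rule chain_bound_strict_image[OF _ _ fs]) (unfold mem_Collect_eq, rule f)
  next
    assume "chain_bound (ideal_interval R I (carrier R)) k"
    then show "chain_bound {N. ideal N (R Quot I)} k"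
      by (rule chain_bound_strict_image[OF _ g gs]) (simp_all only: mem_Collect_eq)
  qed
qed

lemma colength_le:
  assumes "ideal I R" "chain_bound (ideal_interval R I (carrier R)) k"
  shows "colength R I \<le> real k"
proof -
  have "module_length R (quot_module R I) \<le> enat k"
    using assms quot_module_length_le_iff by blast
  then show ?thesis unfolding colength_def
    by (cases "module_length R (quot_module R I)") auto
qed

text \<open>Any finite bound rules out infinite length, so \<open>the_enat\<close> returns the true
  length and the colength is itself a valid chain bound.\<close>

lemma colength_bound:
  assumes "ideal I R" "chain_bound (ideal_interval R I (carrier R)) k"
  obtains l where "colength R I = real l" "chain_bound (ideal_interval R I (carrier R)) l"
proof -
  have *: "module_length R (quot_module R I) \<le> enat k"
    using assms quot_module_length_le_iff by blast
  then obtain l where l: "module_length R (quot_module R I) = enat l"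
    by (cases "module_length R (quot_module R I)") auto
  have "chain_bound (ideal_interval R I (carrier R)) l"
    using quot_module_length_le_iff[OF assms(1), of l] unfolding l by simp
  then show thesis
    by (rule that[rotated]) (simp add: colength_def l)
qed

section \<open>Sums and colons of ideals, and lengths of intervals\<close>

lemma set_add_memE:
  assumes "z \<in> A <+>\<^bsub>R\<^esub> B"
  obtains a b where "a \<in> A" "b \<in> B" "z = a \<oplus> b"
proof -
  have "\<exists>a\<in>A. \<exists>b\<in>B. z = a \<oplus> b" using assms by (simp add: set_add_def')
  then show thesis using that by (elim bexE)
qed

lemma set_add_memI: "a \<in> A \<Longrightarrow> b \<in> B \<Longrightarrow> a \<oplus> b \<in> A <+>\<^bsub>R\<^esub> B"
  unfolding set_add_def' by (intro UN_I) simp_all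

text \<open>The sum is the least ideal containing both summands. Taking \<open>N\<close> to be the
  sum itself yields the inclusions of the summands.\<close>

lemma set_add_ideal_subset_iff:
  assumes "ideal A R" "ideal B R" "ideal N R"
  shows "A <+>\<^bsub>R\<^esub> B \<subseteq> N \<longleftrightarrow> A \<subseteq> N \<and> B \<subseteq> N"
proof -
  interpret A: ideal A R by fact
  interpret B: ideal B R by fact
  interpret N: ideal N R by fact
  have "A \<subseteq> A <+>\<^bsub>R\<^esub> B"
  proof
    fix a assume "a \<in> A"
    then show "a \<in> A <+>\<^bsub>R\<^esub> B" using set_add_memI[OF _ B.zero_closed, of a A] A.Icarr[of a] by simp
  qed
  moreover have "B \<subseteq> A <+>\<^bsub>R\<^esub> B"
  proof
    fix b assume "b \<in> B"
    then show "b \<in> A <+>\<^bsub>R\<^esub> B" using set_add_memI[OF A.zero_closed, of b B] B.Icarr[of b] by simp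
  qed
  moreover have "A <+>\<^bsub>R\<^esub> B \<subseteq> N" if "A \<subseteq> N" "B \<subseteq> N"
    using that by (auto elim!: set_add_memE)
  ultimately show ?thesis by (metis subset_trans)
qed

text \<open>By the modular law, \<open>N\<close> is determined within a chain by \<open>N + M\<close> and \<open>N \<inter> M\<close>.\<close>

lemma chain_bound_ideal_interval_add:
  assumes "ideal M R" "chain_bound (ideal_interval R M K) k" "chain_bound (ideal_interval R I M) l"
    and "I \<subseteq> M" "M \<subseteq> K" "ideal K R"
  shows "chain_bound (ideal_interval R I K) (k + l)"
proof (rule chain_bound_add[OF assms(2,3), where f = "\<lambda>N. N <+>\<^bsub>R\<^esub> M" and g = "\<lambda>N. N \<inter> M"])
  interpret M: ideal M R by fact
  interpret K: ideal K R by fact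
  show "N <+>\<^bsub>R\<^esub> M \<in> ideal_interval R M K" if "N \<in> ideal_interval R I K" for N
  proof -
    have N: "ideal N R" "N \<subseteq> K" using ideal_intervalD[OF that] by simp_all
    have "ideal (N <+>\<^bsub>R\<^esub> M) R" using add_ideals N(1) assms(1) by simp
    moreover have "M \<subseteq> N <+>\<^bsub>R\<^esub> M" "N <+>\<^bsub>R\<^esub> M \<subseteq> K"
      using set_add_ideal_subset_iff[OF N(1) assms(1)] calculation N(2) assms(5,6) by blast+
    ultimately show ?thesis unfolding ideal_interval_def by simp
  qed
  show "N \<inter> M \<in> ideal_interval R I M" if "N \<in> ideal_interval R I K" for N
    using i_intersect[OF _ assms(1), of N] ideal_intervalD[OF that] assms(4)
    unfolding ideal_interval_def by auto
  show False if XY: "V \<in> ideal_interval R I K" "Y \<in> ideal_interval R I K" "V < Y"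
    and eq: "V <+>\<^bsub>R\<^esub> M = Y <+>\<^bsub>R\<^esub> M" "V \<inter> M = Y \<inter> M" for V Y
  proof -
    interpret X: ideal V R using ideal_intervalD[OF XY(1)] by simp
    interpret Y: ideal Y R using ideal_intervalD[OF XY(2)] by simp
    have "Y \<subseteq> V"
    proof
      fix y assume y: "y \<in> Y"
      have "y \<oplus> \<zero> \<in> Y <+>\<^bsub>R\<^esub> M" using y M.zero_closed by (rule set_add_memI)
      then have "y \<in> V <+>\<^bsub>R\<^esub> M" using eq(1) Y.Icarr[OF y] by simp
      then obtain a b where ab: "a \<in> V" "b \<in> M" "y = a \<oplus> b" by (rule set_add_memE)
      \<comment> \<open>Both \<open>a\<close> and \<open>y\<close> lie in \<open>Y\<close>, so
        \<open>b\<close> lies in the intersection of \<open>Y\<close> and \<open>M\<close>, which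
        equals that of \<open>V\<close> and \<open>M\<close>; thus \<open>y\<close> is a sum of two
        elements of \<open>V\<close>.\<close>
      have "b = \<ominus> a \<oplus> y" using X.Icarr[OF ab(1)] M.Icarr[OF ab(2)] ab(3) by (simp add: r_neg1)
      moreover have "a \<in> Y" using ab(1) XY(3) by auto
      ultimately have "b \<in> Y" using y Y.a_closed Y.a_inv_closed by simp
      then have "b \<in> V" using ab(2) eq(2) by auto
      then show "y \<in> V" using ab by simp
    qed
    then show False using XY(3) by auto
  qed
  show "V <+>\<^bsub>R\<^esub> M \<le> Y <+>\<^bsub>R\<^esub> M" if "V < Y" for V Y
    using that by (auto elim!: set_add_memE intro!: set_add_memI)
qed auto

lemma ideal_colon:
  assumes "ideal N R" "y \<in> carrier R"
  shows "ideal {a \<in> carrier R. a \<otimes> y \<in> N} R"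
proof -
  interpret N: ideal N R by fact
  show ?thesis
  proof (rule idealI)
    show "subgroup {a \<in> carrier R. a \<otimes> y \<in> N} (add_monoid R)"
      by (rule add.subgroupI)
        (use assms(2) in \<open>auto simp: l_minus l_distr intro: exI[of _ \<zero>]\<close>)
    show "a \<otimes> b \<in> {a \<in> carrier R. a \<otimes> y \<in> N}"
      if "a \<in> {a \<in> carrier R. a \<otimes> y \<in> N}" "b \<in> carrier R" for a b
      using that assms(2) N.I_l_closed[of "a \<otimes> y" b] by (auto simp: m_ac)
    show "b \<otimes> a \<in> {a \<in> carrier R. a \<otimes> y \<in> N}"
      if "a \<in> {a \<in> carrier R. a \<otimes> y \<in> N}" "b \<in> carrier R" for a b
      using that assms(2) N.I_l_closed[of "a \<otimes> y" b] by (auto simp: m_assoc)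
  qed (rule ring_axioms)
qed

text \<open>\<open>N \<mapsto> (N : y)\<close> is strictly increasing between \<open>K\<close> and \<open>K + (y)\<close>.\<close>

lemma chain_bound_cyclic:
  assumes "ideal C R" "ideal K R" "y \<in> carrier R" "\<And>c. c \<in> C \<Longrightarrow> c \<otimes> y \<in> K"
    and "chain_bound (ideal_interval R C (carrier R)) k"
  shows "chain_bound (ideal_interval R K (K <+>\<^bsub>R\<^esub> PIdl y)) k"
proof (rule chain_bound_strict_image[OF assms(5), where f = "\<lambda>N. {a \<in> carrier R. a \<otimes> y \<in> N}"])
  fix V assume V: "V \<in> ideal_interval R K (K <+>\<^bsub>R\<^esub> PIdl y)"
  have "ideal {a \<in> carrier R. a \<otimes> y \<in> V} R"
    using ideal_intervalD[OF V] by (intro ideal_colon[OF _ assms(3)]) simp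
  \<comment> \<open>Since \<open>C\<close> multiplies \<open>y\<close> into \<open>K\<close>, every
    colon ideal that occurs lies above \<open>C\<close>; this is where the length of
    \<open>R/C\<close> enters.\<close>
  moreover have "C \<subseteq> {a \<in> carrier R. a \<otimes> y \<in> V}"
    using assms(4) ideal_intervalD[OF V] ideal.Icarr[OF assms(1)] by auto
  ultimately show "{a \<in> carrier R. a \<otimes> y \<in> V} \<in> ideal_interval R C (carrier R)"
    unfolding ideal_interval_def by blast
next
  interpret K: ideal K R by fact
  fix V Y assume XY: "V \<in> ideal_interval R K (K <+>\<^bsub>R\<^esub> PIdl y)"
    "Y \<in> ideal_interval R K (K <+>\<^bsub>R\<^esub> PIdl y)" "V < Y"
  interpret X: ideal V R using ideal_intervalD[OF XY(1)] by simp
  interpret Y: ideal Y R using ideal_intervalD[OF XY(2)] by simp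
  \<comment> \<open>Write \<open>z\<close> as an element of \<open>K\<close> plus
    \<open>a \<otimes> y\<close>. The first summand lies in both \<open>V\<close> and
    \<open>Y\<close>, so \<open>a\<close> separates the two colon ideals.\<close>
  obtain z where z: "z \<in> Y" "z \<notin> V" using XY(3) by auto
  then have "z \<in> K <+>\<^bsub>R\<^esub> PIdl y" using ideal_intervalD[OF XY(2)] by auto
  then obtain b c where bc: "b \<in> K" "c \<in> PIdl y" "z = b \<oplus> c" by (rule set_add_memE)
  then obtain a where ab: "a \<in> carrier R" "z = b \<oplus> a \<otimes> y"
    unfolding cgenideal_def by auto
  have bXY: "b \<in> V" "b \<in> Y"
    using bc(1) ideal_intervalD[OF XY(1)] ideal_intervalD[OF XY(2)] by auto
  have "a \<otimes> y = \<ominus> b \<oplus> z" using ab K.Icarr[OF bc(1)] assms(3) by (simp add: r_neg1)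
  then have "a \<otimes> y \<in> Y" using z bXY Y.a_closed Y.a_inv_closed by simp
  moreover have "a \<otimes> y \<notin> V" using z bXY ab X.a_closed by auto
  ultimately have "a \<in> {a \<in> carrier R. a \<otimes> y \<in> Y}" "a \<notin> {a \<in> carrier R. a \<otimes> y \<in> V}"
    using ab(1) by simp_all
  moreover have "{a \<in> carrier R. a \<otimes> y \<in> V} \<subseteq> {a \<in> carrier R. a \<otimes> y \<in> Y}"
    using XY(3) by auto
  ultimately show "{a \<in> carrier R. a \<otimes> y \<in> V} < {a \<in> carrier R. a \<otimes> y \<in> Y}"
    unfolding less_le by metis
qed

lemma chain_bound_ideal_interval_subset:
  "chain_bound (ideal_interval R I K) k \<Longrightarrow> I \<subseteq> I' \<Longrightarrow> K' \<subseteq> K \<Longrightarrow> chain_bound (ideal_interval R I' K') k"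
  by (rule chain_bound_subset) (auto simp: ideal_interval_def)

end

section \<open>Counting exponents, and asymptotic densities\<close>

text \<open>Exponents are total functions; forcing them to vanish off \<open>L\<close> makes each
  one determined by its values on \<open>L\<close>, so that they can be counted.\<close>

definition exponents :: "'i set \<Rightarrow> ('i \<Rightarrow> nat) set" where
  "exponents L = {u. \<forall>i. i \<notin> L \<longrightarrow> u i = 0}"

text \<open>The exponents of the monomials in \<open>I\<^sup>t + J\<^bsup>[q]\<^esup>\<close>, where the variables in \<open>P\<close> generate \<open>I\<close> and
  the others generate \<open>J\<close>; with \<open>P = {}\<close> and \<open>t = 1\<close> this is the complement of a box.\<close>

definition mixed_region :: "'i set \<Rightarrow> 'i set \<Rightarrow> nat \<Rightarrow> nat \<Rightarrow> ('i \<Rightarrow> nat) set" where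
  "mixed_region L P t q = {u \<in> exponents L. t \<le> sum u (L \<inter> P) \<or> (\<exists>i\<in>L - P. q \<le> u i)}"

text \<open>The number of exponents in \<open>r\<close> variables of total degree less than \<open>t\<close>; the case \<open>t = 0\<close> is
  separate because \<open>t - 1\<close> truncates.\<close>

definition simplex_count :: "nat \<Rightarrow> nat \<Rightarrow> nat" where
  "simplex_count r t = (if t = 0 then 0 else (t - 1 + r) choose r)"

text \<open>If one of \<open>r + 1\<close> variables has exponent \<open>j\<close>, the others have
  total degree less than \<open>t - j\<close>. Summing over these slices is the hockey-stick
  identity.\<close>

lemma simplex_count_Suc: "(\<Sum>j<t. simplex_count r (t - j)) = simplex_count (Suc r) t"
proof (cases t)
  case (Suc s)
  have "(\<Sum>j<t. simplex_count r (t - j)) = (\<Sum>j\<le>s. (s - j + r) choose r)"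
    unfolding Suc lessThan_Suc_atMost simplex_count_def
    by (rule sum.cong) (auto simp: Suc_diff_le)
  also have "\<dots> = (\<Sum>j\<le>s. (r + j) choose r)"
    using sum.nat_diff_reindex[of "\<lambda>j. (r + j) choose r" "Suc s"]
    by (simp add: lessThan_Suc_atMost add.commute)
  also have "\<dots> = (r + s + 1) choose (r + 1)" by (rule choose_rising_sum(1))
  finally show ?thesis by (simp add: simplex_count_def Suc add.commute)
qed (simp add: simplex_count_def)

text \<open>Induction on the variables: one in \<open>P\<close> slices the simplex and replaces
  \<open>t\<close> by \<open>t - j\<close>, hence the arbitrary \<open>t\<close>; one outside
  \<open>P\<close> contributes a free factor \<open>q\<close>.\<close>

lemma card_compl_mixed_region:
  assumes "finite L"
  shows "finite (exponents L - mixed_region L P t q) \<and>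
    card (exponents L - mixed_region L P t q) = simplex_count (card (L \<inter> P)) t * q ^ card (L - P)"
  using assms
proof (induction L arbitrary: t rule: finite_induct)
  case empty
  have "exponents {} - mixed_region {} P t q = (if t = 0 then {} else {\<lambda>_. 0})"
    by (auto simp: exponents_def mixed_region_def)
  then show ?case by (auto simp: simplex_count_def)
next
  case (insert a L)
  define D where "D t = exponents L - mixed_region L P t q" for t
  define D' where "D' = exponents (insert a L) - mixed_region (insert a L) P t q"
  have IH: "finite (D t)" "card (D t) = simplex_count (card (L \<inter> P)) t * q ^ card (L - P)" for t
    using insert.IH[of t] unfolding D_def by auto
  have D: "u \<in> D t \<longleftrightarrow> (\<forall>i. i \<notin> L \<longrightarrow> u i = 0) \<and> sum u (L \<inter> P) < t \<and> (\<forall>i\<in>L - P. u i < q)" for u t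
    by (auto simp: D_def mixed_region_def exponents_def not_le)
  have D': "u \<in> D' \<longleftrightarrow> (\<forall>i. i \<notin> insert a L \<longrightarrow> u i = 0) \<and> sum u (insert a L \<inter> P) < t
      \<and> (\<forall>i\<in>insert a L - P. u i < q)" for u
    by (auto simp: D'_def mixed_region_def exponents_def not_le)
  have sum_upd: "(\<Sum>i\<in>L \<inter> P. if i = a then j else u i) = sum u (L \<inter> P)" for u :: "'a \<Rightarrow> nat" and j
    using insert.hyps by (intro sum.cong) auto
  show ?case
  proof (cases "a \<in> P")
    case True
    let ?S = "SIGMA j:{..<t}. D (t - j)"
    have LP: "insert a L \<inter> P = insert a (L \<inter> P)" "insert a L - P = L - P" using True by auto
    \<comment> \<open>A missing exponent is split into its value \<open>j\<close> at the new
      variable and its restriction to the old ones.\<close>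
    have bij: "bij_betw (\<lambda>(j, u). u(a := j)) ?S D'"
    proof (rule bij_betw_byWitness[where f' = "\<lambda>u. (u a, u(a := 0))"])
      show "\<forall>z\<in>?S. (\<lambda>u. (u a, u(a := 0))) ((\<lambda>(j, u). u(a := j)) z) = z"
        using insert.hyps by (auto simp: D fun_eq_iff)
      show "\<forall>u\<in>D'. (\<lambda>(j, u). u(a := j)) (u a, u(a := 0)) = u" by (simp add: D')
      show "(\<lambda>(j, u). u(a := j)) ` ?S \<subseteq> D'"
        using insert.hyps by (auto simp: D D' LP sum_upd)
      show "(\<lambda>u. (u a, u(a := 0))) ` D' \<subseteq> ?S"
        using insert.hyps by (auto simp: D D' LP sum_upd)
    qed
    have "finite ?S" using IH by (intro finite_SigmaI) auto
    then have "finite D'" using bij bij_betw_finite by blast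
    moreover have "card D' = card ?S" using bij_betw_same_card[OF bij] by simp
    moreover have "card ?S = (\<Sum>j<t. simplex_count (card (L \<inter> P)) (t - j)) * q ^ card (L - P)"
      using IH by (simp add: sum_distrib_right)
    moreover have "card (insert a L \<inter> P) = Suc (card (L \<inter> P))"
      unfolding LP using insert.hyps by simp
    ultimately show ?thesis unfolding D'_def[symmetric] simplex_count_Suc LP(2) by simp
  next
    case False
    let ?S = "{..<q} \<times> D t"
    have LP: "insert a L \<inter> P = L \<inter> P" "insert a L - P = insert a (L - P)" using False by auto
    have bij: "bij_betw (\<lambda>(j, u). u(a := j)) ?S D'"
    proof (rule bij_betw_byWitness[where f' = "\<lambda>u. (u a, u(a := 0))"])
      show "\<forall>z\<in>?S. (\<lambda>u. (u a, u(a := 0))) ((\<lambda>(j, u). u(a := j)) z) = z"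
        using insert.hyps by (auto simp: D fun_eq_iff)
      show "\<forall>u\<in>D'. (\<lambda>(j, u). u(a := j)) (u a, u(a := 0)) = u" by (simp add: D')
      show "(\<lambda>(j, u). u(a := j)) ` ?S \<subseteq> D'"
        using insert.hyps by (auto simp: D D' LP sum_upd)
      show "(\<lambda>u. (u a, u(a := 0))) ` D' \<subseteq> ?S"
        using insert.hyps by (auto simp: D D' LP sum_upd)
    qed
    have "finite ?S" using IH by auto
    then have "finite D'" using bij bij_betw_finite by blast
    moreover have "card D' = card ?S" using bij_betw_same_card[OF bij] by simp
    moreover have "card (insert a (L - P)) = Suc (card (L - P))"
      using insert.hyps by simp
    ultimately show ?thesis unfolding D'_def[symmetric] LP using IH by (simp add: card_cartesian_product)
  qed
qed

text \<open>For positive \<open>t\<close> the count is the rising factorial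
  \<open>t (t + 1) ... (t + r - 1)\<close> divided by \<open>r!\<close>; each of its
  \<open>r\<close> factors, divided by \<open>q n\<close>, tends to \<open>s\<close>.\<close>

lemma simplex_count_asymp:
  fixes t q :: "nat \<Rightarrow> nat"
  assumes "filterlim q at_top sequentially" "(\<lambda>n. real (t n) / real (q n)) \<longlonglongrightarrow> s"
    and "eventually (\<lambda>n. t n > 0) sequentially"
  shows "(\<lambda>n. real (simplex_count r (t n)) / real (q n) ^ r) \<longlonglongrightarrow> s ^ r / fact r"
proof -
  have q: "filterlim (\<lambda>n. real (q n)) at_top sequentially"
    using assms(1) by (rule filterlim_compose[OF filterlim_real_sequentially])
  have "(\<lambda>n. real (t n) / real (q n) + real i / real (q n)) \<longlonglongrightarrow> s + 0" for i
    by (intro tendsto_add assms(2) real_tendsto_divide_at_top[OF tendsto_const q])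
  then have "(\<lambda>n. (real (t n) + real i) / real (q n)) \<longlonglongrightarrow> s" for i
    by (simp add: add_divide_distrib)
  then have "(\<lambda>n. (\<Prod>i<r. (real (t n) + real i) / real (q n)) / fact r) \<longlonglongrightarrow> (\<Prod>i<r. s) / fact r"
    by (intro tendsto_intros) (simp_all add: fact_nonzero)
  moreover have "\<forall>\<^sub>F n in sequentially. (\<Prod>i<r. (real (t n) + real i) / real (q n)) / fact r
      = real (simplex_count r (t n)) / real (q n) ^ r"
    using assms(3)
  proof eventually_elim
    case (elim n)
    have "real ((t n - 1 + r) choose r) = pochhammer (real (t n)) r / fact r"
      using elim by (simp add: binomial_gbinomial gbinomial_pochhammer' of_nat_diff)
    then show ?case using elim
      by (simp add: simplex_count_def pochhammer_prod prod_dividef atLeast0LessThan)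
  qed
  ultimately show ?thesis using Lim_transform_eventually by fastforce
qed

lemma tendsto_div_const:
  fixes t q :: "nat \<Rightarrow> nat"
  assumes "filterlim q at_top sequentially" "(\<lambda>n. real (t n) / real (q n)) \<longlonglongrightarrow> s" "k > 0"
  shows "(\<lambda>n. real (t n div k) / real (q n)) \<longlonglongrightarrow> s / real k"
proof (rule tendsto_sandwich)
  have q: "filterlim (\<lambda>n. real (q n)) at_top sequentially"
    using assms(1) by (rule filterlim_compose[OF filterlim_real_sequentially])
  have "(\<lambda>n. real (t n) / real (q n) / real k - 1 / real (q n)) \<longlonglongrightarrow> s / real k - 0"
    using assms(3) by (intro tendsto_diff tendsto_divide tendsto_const assms(2)
      real_tendsto_divide_at_top[OF tendsto_const q]) auto
  then show "(\<lambda>n. real (t n) / real (q n) / real k - 1 / real (q n)) \<longlonglongrightarrow> s / real k" by simp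
  show "(\<lambda>n. real (t n) / real (q n) / real k) \<longlonglongrightarrow> s / real k"
    using assms(3) by (intro tendsto_intros assms(2)) auto
  have b: "real m / real k - 1 \<le> real (m div k)" "real (m div k) \<le> real m / real k" for m
  proof -
    show "real (m div k) \<le> real m / real k" by (rule of_nat_div_le_of_nat)
    have "real m \<le> real (k + k * (m div k))"
      using dividend_less_times_div[OF assms(3), of m] by linarith
    then have "real m / real k \<le> real (m div k) + 1"
      using assms(3) by (simp add: field_simps)
    then show "real m / real k - 1 \<le> real (m div k)" by simp
  qed
  show "\<forall>\<^sub>F n in sequentially. real (t n) / real (q n) / real k - 1 / real (q n) \<le> real (t n div k) / real (q n)"
  proof (rule always_eventually, rule allI)
    fix n
    have "(real (t n) / real k - 1) / real (q n) \<le> real (t n div k) / real (q n)"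
      by (rule divide_right_mono[OF b(1)]) simp
    then show "real (t n) / real (q n) / real k - 1 / real (q n) \<le> real (t n div k) / real (q n)"
      by (simp add: diff_divide_distrib mult.commute)
  qed
  show "\<forall>\<^sub>F n in sequentially. real (t n div k) / real (q n) \<le> real (t n) / real (q n) / real k"
  proof (rule always_eventually, rule allI)
    fix n
    have "real (t n div k) / real (q n) \<le> (real (t n) / real k) / real (q n)"
      by (rule divide_right_mono[OF b(2)]) simp
    then show "real (t n div k) / real (q n) \<le> real (t n) / real (q n) / real k"
      by (simp add: mult.commute)
  qed
qed

text \<open>The bounds depend on an auxiliary scale \<open>k\<close>. For each fixed
  \<open>k\<close> first \<open>n\<close> grows; afterwards \<open>k\<close> grows in the limits
  \<open>l'\<close> and \<open>u'\<close>. No uniformity in \<open>k\<close> is asked for.\<close>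

lemma tendsto_iterated_sandwich:
  fixes g :: "nat \<Rightarrow> real"
  assumes "\<And>k. \<forall>\<^sub>F n in sequentially. l k n \<le> g n" "\<And>k. \<forall>\<^sub>F n in sequentially. g n \<le> u k n"
    and "\<And>k. l k \<longlonglongrightarrow> l' k" "\<And>k. u k \<longlonglongrightarrow> u' k"
    and "l' \<longlonglongrightarrow> z" "u' \<longlonglongrightarrow> z"
  shows "g \<longlonglongrightarrow> z"
proof (rule order_tendstoI)
  fix a assume "a < z"
  then have "\<forall>\<^sub>F k in sequentially. a < l' k" using assms(5) order_tendstoD(1) by blast
  then obtain k where "a < l' k" by (auto simp: eventually_sequentially)
  then have "\<forall>\<^sub>F n in sequentially. a < l k n" using assms(3) order_tendstoD(1) by blast
  with assms(1)[of k] show "\<forall>\<^sub>F n in sequentially. a < g n" by eventually_elim simp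
next
  fix a assume "z < a"
  then have "\<forall>\<^sub>F k in sequentially. u' k < a" using assms(6) order_tendstoD(2) by blast
  then obtain k where "u' k < a" by (auto simp: eventually_sequentially)
  then have "\<forall>\<^sub>F n in sequentially. u k n < a" using assms(4) order_tendstoD(2) by blast
  with assms(2)[of k] show "\<forall>\<^sub>F n in sequentially. g n < a" by eventually_elim simp
qed

text \<open>A multiplicative form of Fekete's argument: the limit is the infimum of
  \<open>F k / k ^ d\<close>. If \<open>k\<close> nearly attains it, then \<open>n\<close> is at
  most \<open>k * Suc (n div k)\<close>, and the scaling bound controls \<open>F n\<close> for all
  large \<open>n\<close>.\<close>

lemma power_density_exists:
  fixes F :: "nat \<Rightarrow> real"
  assumes "\<And>n. F n \<ge> 0" "\<And>m n. m \<le> n \<Longrightarrow> F m \<le> F n"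
    and "\<And>k M. k > 0 \<Longrightarrow> F (k * M) \<le> real M ^ d * F k"
  shows "\<exists>c. (\<lambda>n. F n / real n ^ d) \<longlonglongrightarrow> c \<and> (\<forall>k>0. c * real k ^ d \<le> F k)"
proof -
  define S where "S = (\<lambda>k. F k / real k ^ d) ` {0<..}"
  define c where "c = Inf S"
  have bdd: "bdd_below S" unfolding S_def by (intro bdd_belowI[of _ 0]) (auto simp: assms(1))
  have c_le: "c \<le> F k / real k ^ d" if "k > 0" for k
    unfolding c_def by (rule cInf_lower[OF _ bdd]) (use that in \<open>auto simp: S_def\<close>)
  have "(\<lambda>n. F n / real n ^ d) \<longlonglongrightarrow> c"
  proof (rule order_tendstoI)
    fix a assume "a < c"
    then show "\<forall>\<^sub>F n in sequentially. a < F n / real n ^ d"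
      using c_le by (auto intro!: eventually_mono[OF eventually_gt_at_top[of 0]] elim: less_le_trans)
  next
    fix a assume "c < a"
    then obtain k where k: "k > 0" "F k / real k ^ d < a"
      using cInf_less_iff[OF _ bdd] unfolding c_def S_def by auto
    have id: "filterlim (\<lambda>n::nat. n) at_top sequentially" by (rule filterlim_ident)
    have "(\<lambda>n. real n / real n) \<longlonglongrightarrow> 1"
      by (rule tendsto_eventually) (auto intro: eventually_mono[OF eventually_gt_at_top[of 0]])
    from tendsto_div_const[OF id this k(1)]
    \<comment> \<open>The number of blocks of length \<open>k\<close> needed to cover
      \<open>n\<close>, divided by \<open>n\<close>, tends to \<open>1 / k\<close>; the upper bound
      thus tends to \<open>F k / k ^ d\<close>, which is below \<open>a\<close>.\<close>
    have "(\<lambda>n. (real (n div k) / real n + 1 / real n) ^ d * F k) \<longlonglongrightarrow> (1 / real k + 0) ^ d * F k"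
      by (intro tendsto_mult tendsto_power tendsto_add tendsto_const
        real_tendsto_divide_at_top[OF tendsto_const filterlim_real_sequentially])
    moreover have "(1 / real k + 0) ^ d * F k < a" using k by (simp add: power_divide)
    ultimately have "\<forall>\<^sub>F n in sequentially. (real (n div k) / real n + 1 / real n) ^ d * F k < a"
      using order_tendstoD(2) by blast
    then show "\<forall>\<^sub>F n in sequentially. F n / real n ^ d < a"
    proof (rule eventually_mono)
      fix n assume *: "(real (n div k) / real n + 1 / real n) ^ d * F k < a"
      have "n \<le> k * Suc (n div k)"
        using k(1) by (metis dividend_less_times_div less_imp_le mult_Suc_right add.commute)
      then have "F n \<le> F (k * Suc (n div k))" by (rule assms(2))
      also have "\<dots> \<le> real (Suc (n div k)) ^ d * F k" by (rule assms(3)[OF k(1)])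
      finally have "F n / real n ^ d \<le> real (Suc (n div k)) ^ d * F k / real n ^ d"
        by (rule divide_right_mono) simp
      also have "\<dots> = (real (n div k) / real n + 1 / real n) ^ d * F k"
        by (simp add: add_divide_distrib[symmetric] power_divide add.commute)
      finally show "F n / real n ^ d < a" using * by simp
    qed
  qed
  then show ?thesis
    using c_le by (intro exI[of _ c] conjI) (simp_all add: pos_le_divide_eq)
qed

text \<open>The numerical core, with \<open>G\<close> the colength for a region and
  \<open>F k\<close> that of the ideal of \<open>k\<close>-th powers. \<open>upper\<close> covers
  the missing exponents by boxes of side \<open>k\<close>. \<open>lower\<close> estimates the rest
  of a large box from above, while the whole box has at least density \<open>c\<close>. Both bounds
  have the same limit because \<open>F k / k ^ (r + e)\<close> tends to \<open>c\<close>.\<close>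

lemma mixed_density_limit:
  fixes F :: "nat \<Rightarrow> real" and G :: "nat \<Rightarrow> nat \<Rightarrow> real" and t q :: "nat \<Rightarrow> nat"
  assumes F: "(\<lambda>n. F n / real n ^ (r + e)) \<longlonglongrightarrow> c" "\<And>k. k > 0 \<Longrightarrow> c * real k ^ (r + e) \<le> F k"
    and upper: "\<And>k t q. k > 0 \<Longrightarrow>
      G t q \<le> real (simplex_count r (Suc (t div k)) * Suc (q div k) ^ e) * F k"
    and lower: "\<And>k M t q. k > 0 \<Longrightarrow> t div k - r \<le> M \<Longrightarrow> q div k \<le> M \<Longrightarrow> 0 < M \<Longrightarrow>
      F (k * M) \<le> G t q + (real M ^ (r + e)
        - real (simplex_count r (t div k - r) * (q div k) ^ e)) * F k"
    and q: "filterlim q at_top sequentially" and s: "(\<lambda>n. real (t n) / real (q n)) \<longlonglongrightarrow> s" "s > 0"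
  shows "(\<lambda>n. G (t n) (q n) / real (q n) ^ (r + e)) \<longlonglongrightarrow> c * s ^ r / fact r"
proof -
  have q': "filterlim (\<lambda>n. real (q n)) at_top sequentially"
    using q by (rule filterlim_compose[OF filterlim_real_sequentially])
  have inv0: "(\<lambda>n. x / real (q n)) \<longlonglongrightarrow> 0" for x
    by (rule real_tendsto_divide_at_top[OF tendsto_const q'])
  \<comment> \<open>The quotient is \<open>1\<close> only eventually: \<open>q n\<close> may vanish
    at first, where division by zero gives \<open>0\<close>.\<close>
  have q1: "(\<lambda>n. real (q n) / real (q n)) \<longlonglongrightarrow> 1"
    using filterlim_at_top_dense[THEN iffD1, OF q', rule_format, of 0]
    by (intro tendsto_eventually) (auto elim: eventually_mono)
  define K where "K k = Suc k" for k
  have K: "K k > 0" for k by (simp add: K_def)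
  define T where "T k n = t n div K k" for k n
  define Q where "Q k n = q n div K k" for k n
  have T: "(\<lambda>n. real (T k n) / real (q n)) \<longlonglongrightarrow> s / real (K k)" for k
    unfolding T_def by (rule tendsto_div_const[OF q s(1) K])
  have Q: "(\<lambda>n. real (Q k n) / real (q n)) \<longlonglongrightarrow> 1 / real (K k)" for k
    unfolding Q_def by (rule tendsto_div_const[OF q q1 K])
  have T1: "(\<lambda>n. real (Suc (T k n)) / real (q n)) \<longlonglongrightarrow> s / real (K k)" for k
    using tendsto_add[OF T[of k] inv0[of 1]] by (simp add: add_divide_distrib add.commute)
  have Q1: "(\<lambda>n. real (Suc (Q k n)) / real (q n)) \<longlonglongrightarrow> 1 / real (K k)" for k
    using tendsto_add[OF Q[of k] inv0[of 1]] by (simp add: add_divide_distrib add.commute)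
  \<comment> \<open>Once this holds, the truncated subtraction \<open>T k n - r\<close> is an honest
    one with positive value, and the degenerate case of \<open>simplex_count\<close> is
    excluded.\<close>
  have Tbig: "\<forall>\<^sub>F n in sequentially. r < T k n" for k
  proof -
    have "(\<lambda>n. real (T k n) / real (q n) - real r / real (q n)) \<longlonglongrightarrow> s / real (K k) - 0"
      by (intro tendsto_diff T inv0)
    moreover have "0 < s / real (K k) - 0" using s(2) K[of k] by simp
    ultimately have "\<forall>\<^sub>F n in sequentially. 0 < real (T k n) / real (q n) - real r / real (q n)"
      by (rule order_tendstoD(1))
    then show ?thesis
    proof (rule eventually_mono)
      fix n assume "0 < real (T k n) / real (q n) - real r / real (q n)"
      then have "0 < (real (T k n) - real r) / real (q n)" by (simp add: diff_divide_distrib)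
      then show "r < T k n" by (simp add: zero_less_divide_iff)
    qed
  qed
  have T0: "(\<lambda>n. real (T k n - r) / real (q n)) \<longlonglongrightarrow> s / real (K k)" for k
  proof (rule Lim_transform_eventually)
    show "(\<lambda>n. real (T k n) / real (q n) - real r / real (q n)) \<longlonglongrightarrow> s / real (K k)"
      using tendsto_diff[OF T[of k] inv0[of "real r"]] by simp
    show "\<forall>\<^sub>F n in sequentially. real (T k n) / real (q n) - real r / real (q n) = real (T k n - r) / real (q n)"
      using Tbig[of k] by eventually_elim (simp add: of_nat_diff diff_divide_distrib)
  qed
  have N1: "(\<lambda>n. real (simplex_count r (Suc (T k n))) / real (q n) ^ r) \<longlonglongrightarrow> (s / real (K k)) ^ r / fact r" for k
    by (rule simplex_count_asymp[OF q T1]) simp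
  have N0: "(\<lambda>n. real (simplex_count r (T k n - r)) / real (q n) ^ r) \<longlonglongrightarrow> (s / real (K k)) ^ r / fact r" for k
    by (rule simplex_count_asymp[OF q T0]) (use Tbig[of k] in \<open>auto elim: eventually_mono\<close>)
  \<comment> \<open>Side of the enclosing box in units of \<open>K k\<close>: positive, at least as
    large as both thresholds, and asymptotically proportional to \<open>q n\<close>.\<close>
  define M where "M k n = Suc (T k n + Q k n)" for k n
  have M: "(\<lambda>n. real (M k n) / real (q n)) \<longlonglongrightarrow> (s + 1) / real (K k)" for k
    using tendsto_add[OF tendsto_add[OF T[of k] Q[of k]] inv0[of 1]]
    by (simp add: M_def add_divide_distrib add_ac)
  define u where "u k n = real (simplex_count r (Suc (T k n))) / real (q n) ^ r
    * (real (Suc (Q k n)) / real (q n)) ^ e * F (K k)" for k n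
  \<comment> \<open>The normalised lower bound: the least possible value for the whole box, minus
    the estimate for the part of the box inside the region.\<close>
  define l where "l k n = c * real (K k) ^ (r + e) * (real (M k n) / real (q n)) ^ (r + e)
    - ((real (M k n) / real (q n)) ^ (r + e)
      - real (simplex_count r (T k n - r)) / real (q n) ^ r * (real (Q k n) / real (q n)) ^ e) * F (K k)"
    for k n
  define u' where "u' k = (s / real (K k)) ^ r / fact r * (1 / real (K k)) ^ e * F (K k)" for k
  define l' where "l' k = c * real (K k) ^ (r + e) * ((s + 1) / real (K k)) ^ (r + e)
    - (((s + 1) / real (K k)) ^ (r + e)
      - (s / real (K k)) ^ r / fact r * (1 / real (K k)) ^ e) * F (K k)" for k
  have FK: "(\<lambda>k. F (K k) / real (K k) ^ (r + e)) \<longlonglongrightarrow> c"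
    unfolding K_def by (rule LIMSEQ_Suc[OF F(1)])
  show ?thesis
  proof (rule tendsto_iterated_sandwich[where l = l and u = u and l' = l' and u' = u'])
    show "u k \<longlonglongrightarrow> u' k" for k
      unfolding u_def u'_def by (intro tendsto_intros N1 Q1)
    show "l k \<longlonglongrightarrow> l' k" for k
      unfolding l_def l'_def by (intro tendsto_intros N0 Q M)
    have "u' = (\<lambda>k. s ^ r / fact r * (F (K k) / real (K k) ^ (r + e)))"
      unfolding u'_def by (simp add: power_divide power_add mult_ac)
    then show "u' \<longlonglongrightarrow> c * s ^ r / fact r"
      using tendsto_mult_left[OF FK, of "s ^ r / fact r"] by (simp add: mult_ac)
    have "l' k = c * (s + 1) ^ (r + e) - ((s + 1) ^ (r + e) - s ^ r / fact r) * (F (K k) / real (K k) ^ (r + e))" for k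
      using K[of k] unfolding l'_def by (simp add: power_divide power_add field_simps)
    then have "l' = (\<lambda>k. c * (s + 1) ^ (r + e) - ((s + 1) ^ (r + e) - s ^ r / fact r) * (F (K k) / real (K k) ^ (r + e)))"
      by (rule ext)
    moreover have "(\<lambda>k. c * (s + 1) ^ (r + e) - ((s + 1) ^ (r + e) - s ^ r / fact r) * (F (K k) / real (K k) ^ (r + e)))
       \<longlonglongrightarrow> c * (s + 1) ^ (r + e) - ((s + 1) ^ (r + e) - s ^ r / fact r) * c"
      by (intro tendsto_intros FK)
    \<comment> \<open>The volume of the auxiliary box cancels, and only the volume of the missing
      exponents remains.\<close>
    moreover have "c * (s + 1) ^ (r + e) - ((s + 1) ^ (r + e) - s ^ r / fact r) * c = c * s ^ r / fact r"
      by (simp add: algebra_simps)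
    ultimately show "l' \<longlonglongrightarrow> c * s ^ r / fact r" by simp
    show "\<forall>\<^sub>F n in sequentially. G (t n) (q n) / real (q n) ^ (r + e) \<le> u k n" for k
    proof (rule always_eventually, rule allI)
      fix n
      have "G (t n) (q n) \<le> real (simplex_count r (Suc (T k n)) * Suc (Q k n) ^ e) * F (K k)"
        unfolding T_def Q_def by (rule upper[OF K])
      then have "G (t n) (q n) / real (q n) ^ (r + e)
          \<le> real (simplex_count r (Suc (T k n)) * Suc (Q k n) ^ e) * F (K k) / real (q n) ^ (r + e)"
        by (rule divide_right_mono) simp
      then show "G (t n) (q n) / real (q n) ^ (r + e) \<le> u k n"
        unfolding u_def by (simp add: power_divide power_add)
    qed
    show "\<forall>\<^sub>F n in sequentially. l k n \<le> G (t n) (q n) / real (q n) ^ (r + e)" for k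
    proof (rule always_eventually, rule allI)
      fix n
      have "F (K k * M k n) \<le> G (t n) (q n) + (real (M k n) ^ (r + e)
          - real (simplex_count r (T k n - r) * Q k n ^ e)) * F (K k)"
        unfolding T_def Q_def by (rule lower[OF K]) (simp_all add: M_def T_def Q_def)
      moreover have "c * real (K k * M k n) ^ (r + e) \<le> F (K k * M k n)"
        by (rule F(2)) (simp add: K_def M_def)
      ultimately have "c * real (K k * M k n) ^ (r + e) - (real (M k n) ^ (r + e)
          - real (simplex_count r (T k n - r) * Q k n ^ e)) * F (K k) \<le> G (t n) (q n)" by linarith
      then have "(c * real (K k * M k n) ^ (r + e) - (real (M k n) ^ (r + e)
          - real (simplex_count r (T k n - r) * Q k n ^ e)) * F (K k)) / real (q n) ^ (r + e)
          \<le> G (t n) (q n) / real (q n) ^ (r + e)"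
        by (rule divide_right_mono) simp
      then show "l k n \<le> G (t n) (q n) / real (q n) ^ (r + e)"
        unfolding l_def
        by (simp add: power_divide power_add power_mult_distrib diff_divide_distrib left_diff_distrib right_diff_distrib mult_ac)
    qed
  qed
qed

section \<open>Monomial ideals\<close>

definition monomial :: "('a, 'b) ring_scheme \<Rightarrow> 'i set \<Rightarrow> ('i \<Rightarrow> 'a) \<Rightarrow> ('i \<Rightarrow> nat) \<Rightarrow> 'a" where
  "monomial R L x u = finprod R (\<lambda>i. x i [^]\<^bsub>R\<^esub> u i) L"

definition monomial_ideal ::
  "('a, 'b) ring_scheme \<Rightarrow> 'i set \<Rightarrow> ('i \<Rightarrow> 'a) \<Rightarrow> ('i \<Rightarrow> nat) set \<Rightarrow> 'a set" where
  "monomial_ideal R L x U = Idl\<^bsub>R\<^esub> (monomial R L x ` U)"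

definition up_closed :: "'i set \<Rightarrow> ('i \<Rightarrow> nat) set \<Rightarrow> bool" where
  "up_closed L U \<longleftrightarrow> (\<forall>u\<in>U. \<forall>i\<in>L. u(i := Suc (u i)) \<in> U)"

lemma mixed_region_subset: "mixed_region L P t q \<subseteq> exponents L"
  by (auto simp: mixed_region_def)

lemma up_closed_exponents: "up_closed L (exponents L)"
  by (auto simp: up_closed_def exponents_def)

lemma mixed_region_upward:
  assumes "u \<in> mixed_region L P t q" "v \<in> exponents L" "\<And>i. i \<in> L \<Longrightarrow> u i \<le> v i"
  shows "v \<in> mixed_region L P t q"
proof -
  have "t \<le> sum u (L \<inter> P) \<or> (\<exists>i\<in>L - P. q \<le> u i)"
    using assms(1) by (simp add: mixed_region_def)
  then have "t \<le> sum v (L \<inter> P) \<or> (\<exists>i\<in>L - P. q \<le> v i)"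
  proof (elim disjE bexE)
    assume "t \<le> sum u (L \<inter> P)"
    moreover have "sum u (L \<inter> P) \<le> sum v (L \<inter> P)"
      using assms(3) by (intro sum_mono) auto
    ultimately show ?thesis by linarith
  next
    fix i assume "i \<in> L - P" "q \<le> u i"
    then show ?thesis using assms(3)[of i] le_trans by blast
  qed
  then show ?thesis using assms(2) by (simp add: mixed_region_def)
qed

lemma up_closed_mixed_region: "up_closed L (mixed_region L P t q)"
  unfolding up_closed_def
proof (intro ballI)
  fix u i assume u: "u \<in> mixed_region L P t q" "i \<in> L"
  show "u(i := Suc (u i)) \<in> mixed_region L P t q"
    by (rule mixed_region_upward[OF u(1)])
      (use u in \<open>auto simp: mixed_region_def exponents_def\<close>)
qed

context cring
begin

text \<open>The elements multiplying \<open>y\<close> into \<open>N\<close> form an ideal, so it is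
  enough to test generators.\<close>

lemma genideal_colon_subset:
  assumes "ideal N R" "y \<in> carrier R" "S \<subseteq> carrier R" "\<And>a. a \<in> S \<Longrightarrow> a \<otimes> y \<in> N" "c \<in> Idl S"
  shows "c \<otimes> y \<in> N"
proof -
  have "Idl S \<subseteq> {a \<in> carrier R. a \<otimes> y \<in> N}"
    by (rule genideal_minimal[OF ideal_colon[OF assms(1,2)]]) (use assms(3,4) in auto)
  then show ?thesis using assms(5) by auto
qed

lemma monomial_closed [simp, intro]:
  "x \<in> L \<rightarrow> carrier R \<Longrightarrow> monomial R L x u \<in> carrier R"
  unfolding monomial_def by (intro finprod_closed) auto

lemma monomial_add:
  assumes "x \<in> L \<rightarrow> carrier R"
  shows "monomial R L x (\<lambda>i. u i + v i) = monomial R L x u \<otimes> monomial R L x v"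
proof -
  have "monomial R L x (\<lambda>i. u i + v i) = (\<Otimes>i\<in>L. x i [^] u i \<otimes> x i [^] v i)"
    unfolding monomial_def
    by (rule finprod_cong') (use assms in \<open>auto simp: nat_pow_mult Pi_iff\<close>)
  also have "\<dots> = monomial R L x u \<otimes> monomial R L x v"
    unfolding monomial_def by (rule finprod_multf) (use assms in auto)
  finally show ?thesis .
qed

lemma monomial_single:
  assumes "x \<in> L \<rightarrow> carrier R" "finite L" "i \<in> L"
  shows "monomial R L x (\<lambda>j. if j = i then n else 0) = x i [^] n"
proof -
  have "monomial R L x (\<lambda>j. if j = i then n else 0) = (\<Otimes>j\<in>L. if i = j then x j [^] n else \<one>)"
    unfolding monomial_def
    by (rule finprod_cong') (use assms in \<open>auto simp: Pi_iff\<close>)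
  also have "\<dots> = x i [^] n"
    using finprod_singleton[OF assms(3,2), of "\<lambda>j. x j [^] n"] assms(1) by auto
  finally show ?thesis .
qed

lemma monomial_zero: "x \<in> L \<rightarrow> carrier R \<Longrightarrow> monomial R L x (\<lambda>_. 0) = \<one>"
  unfolding monomial_def by (simp add: finprod_one_eqI)

lemma monomial_Suc:
  assumes "x \<in> L \<rightarrow> carrier R" "finite L" "i \<in> L"
  shows "monomial R L x (u(i := Suc (u i))) = x i \<otimes> monomial R L x u"
proof -
  have "u(i := Suc (u i)) = (\<lambda>j. (if j = i then 1 else 0) + u j)" by auto
  moreover have "x i [^] (1::nat) = x i" using assms(1,3) by (auto simp: Pi_iff)
  ultimately show ?thesis using monomial_add[OF assms(1)] monomial_single[OF assms, of 1] by simp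
qed

lemma monomial_power:
  assumes "x \<in> L \<rightarrow> carrier R"
  shows "monomial R L (\<lambda>i. x i [^] k) u = monomial R L x (\<lambda>i. k * u i)"
  unfolding monomial_def
  by (rule finprod_cong') (use assms in \<open>auto simp: nat_pow_pow Pi_iff\<close>)

text \<open>On \<open>L\<close> the exponent \<open>v\<close> is \<open>u\<close> plus the
  difference \<open>v - u\<close>, so the second monomial is a multiple of the first.\<close>

lemma monomial_mono:
  assumes "x \<in> L \<rightarrow> carrier R" "ideal N R" "monomial R L x u \<in> N" "\<And>i. i \<in> L \<Longrightarrow> u i \<le> v i"
  shows "monomial R L x v \<in> N"
proof -
  interpret N: ideal N R by fact
  have "monomial R L x v = monomial R L x (\<lambda>i. (v i - u i) + u i)"
    unfolding monomial_def
    by (rule finprod_cong') (use assms in \<open>auto simp: Pi_iff\<close>)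
  then show ?thesis
    using monomial_add[OF assms(1)] N.I_l_closed[OF assms(3) monomial_closed[OF assms(1)]] by simp
qed

lemma monomial_ideal_ideal [simp, intro]:
  "x \<in> L \<rightarrow> carrier R \<Longrightarrow> ideal (monomial_ideal R L x U) R"
  unfolding monomial_ideal_def by (intro genideal_ideal) auto

lemma monomial_mem:
  "x \<in> L \<rightarrow> carrier R \<Longrightarrow> u \<in> U \<Longrightarrow> monomial R L x u \<in> monomial_ideal R L x U"
  unfolding monomial_ideal_def by (rule subsetD[OF genideal_self]) auto

lemma monomial_ideal_subsetI:
  "ideal N R \<Longrightarrow> (\<And>u. u \<in> U \<Longrightarrow> monomial R L x u \<in> N) \<Longrightarrow> monomial_ideal R L x U \<subseteq> N"
  unfolding monomial_ideal_def by (intro genideal_minimal) auto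

lemma monomial_ideal_mono:
  "x \<in> L \<rightarrow> carrier R \<Longrightarrow> W \<subseteq> U \<Longrightarrow> monomial_ideal R L x W \<subseteq> monomial_ideal R L x U"
  by (intro monomial_ideal_subsetI) (auto intro: monomial_mem)

lemma monomial_ideal_exponents:
  assumes "x \<in> L \<rightarrow> carrier R"
  shows "monomial_ideal R L x (exponents L) = carrier R"
proof -
  interpret N: ideal "monomial_ideal R L x (exponents L)" R using assms by blast
  have "(\<lambda>_. 0) \<in> exponents L" by (simp add: exponents_def)
  from monomial_mem[OF assms this] show ?thesis
    by (intro N.one_imp_carrier) (simp add: monomial_zero[OF assms])
qed

text \<open>This brings the adjunction of one exponent into the form \<open>K + (y)\<close> to which
  \<open>chain_bound_cyclic\<close> applies.\<close>

lemma monomial_ideal_insert: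
  assumes "x \<in> L \<rightarrow> carrier R"
  shows "monomial_ideal R L x (insert u W) = monomial_ideal R L x W <+>\<^bsub>R\<^esub> PIdl (monomial R L x u)"
proof -
  have u: "monomial R L x u \<in> carrier R" using assms by blast
  have W: "ideal (monomial_ideal R L x W) R" and uW: "ideal (monomial_ideal R L x (insert u W)) R"
    using assms by blast+
  have id: "ideal (monomial_ideal R L x W <+>\<^bsub>R\<^esub> PIdl (monomial R L x u)) R"
    by (rule add_ideals[OF W cgenideal_ideal[OF u]])
  have "monomial_ideal R L x W \<subseteq> monomial_ideal R L x W <+>\<^bsub>R\<^esub> PIdl (monomial R L x u)
      \<and> PIdl (monomial R L x u) \<subseteq> monomial_ideal R L x W <+>\<^bsub>R\<^esub> PIdl (monomial R L x u)"
    using set_add_ideal_subset_iff[OF W cgenideal_ideal[OF u] id] by simp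
  then have "monomial_ideal R L x (insert u W) \<subseteq> monomial_ideal R L x W <+>\<^bsub>R\<^esub> PIdl (monomial R L x u)"
    using monomial_mem[OF assms, of _ W] cgenideal_self[OF u]
    by (intro monomial_ideal_subsetI[OF id]) auto
  moreover have "monomial_ideal R L x W <+>\<^bsub>R\<^esub> PIdl (monomial R L x u) \<subseteq> monomial_ideal R L x (insert u W)"
    unfolding set_add_ideal_subset_iff[OF W cgenideal_ideal[OF u] uW]
    using monomial_ideal_mono[OF assms, of W "insert u W"] monomial_mem[OF assms, of u "insert u W"]
    by (auto intro: subsetD[OF cgenideal_minimal[OF uW]])
  ultimately show ?thesis by (rule subset_antisym)
qed

text \<open>Induction on the number of exponents in \<open>U\<close> missing from \<open>W\<close>:
  each is adjoined at a cost of at most \<open>k\<close>, since the new quotient is cyclic and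
  killed by the ideal of the variables.\<close>

lemma chain_bound_monomial_interval:
  assumes x: "x \<in> L \<rightarrow> carrier R" "finite L"
    and k: "chain_bound (ideal_interval R (Idl (x ` L)) (carrier R)) k"
    and U: "up_closed L U" "up_closed L W" "W \<subseteq> U" "finite (U - W)"
  shows "chain_bound (ideal_interval R (monomial_ideal R L x W) (monomial_ideal R L x U))
    (card (U - W) * k)"
  using U(2-4)
proof (induction "card (U - W)" arbitrary: W)
  case 0
  then have "U = W" by auto
  then show ?case
    by (intro chain_boundI[where \<rho> = "\<lambda>_. 0"]) (auto simp: ideal_interval_def)
next
  case (Suc n)
  then have "U - W \<noteq> {}" by (metis card.empty nat.distinct(1))
  then have "Max ((\<lambda>u. sum u L) ` (U - W)) \<in> (\<lambda>u. sum u L) ` (U - W)"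
    using Suc.prems by simp
  then obtain u where u: "u \<in> U - W" "sum u L = Max ((\<lambda>u. sum u L) ` (U - W))" by auto
  have Max: "sum v L \<le> sum u L" if "v \<in> U - W" for v
    unfolding u(2) using Suc.prems that by (intro Max_ge) auto
  \<comment> \<open>As \<open>u\<close> has the largest degree among the missing exponents, raising
    any coordinate lands in \<open>W\<close>. So every variable multiplies the new monomial into the
    old ideal, and \<open>insert u W\<close> is again closed upwards.\<close>
  have up: "u(i := Suc (u i)) \<in> W" if i: "i \<in> L" for i
  proof (rule ccontr)
    assume "u(i := Suc (u i)) \<notin> W"
    then have "u(i := Suc (u i)) \<in> U - W" using u i U(1) by (auto simp: up_closed_def)
    moreover have "sum u L < sum (u(i := Suc (u i))) L"
      by (rule sum_strict_mono_ex1[OF x(2)]) (use i in auto)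
    ultimately show False using Max by fastforce
  qed
  define W' where "W' = insert u W"
  have W': "U - W' = (U - W) - {u}" "W' \<subseteq> U" using u Suc.prems by (auto simp: W'_def)
  have card: "card (U - W) = Suc (card (U - W'))"
    unfolding W'(1) using u Suc.prems by (metis card.remove)
  have "up_closed L W'" using up Suc.prems(1) by (auto simp: W'_def up_closed_def)
  then have IH: "chain_bound (ideal_interval R (monomial_ideal R L x W') (monomial_ideal R L x U))
      (card (U - W') * k)"
    using Suc.hyps(2) card W' Suc.prems by (intro Suc.hyps(1)) auto
  have W: "ideal (monomial_ideal R L x W) R" using x by blast
  have xL: "x ` L \<subseteq> carrier R" using x by auto
  have "chain_bound (ideal_interval R (monomial_ideal R L x W) (monomial_ideal R L x W')) k"
    unfolding W'_def monomial_ideal_insert[OF x(1)]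
  proof (rule chain_bound_cyclic[OF genideal_ideal[OF xL] W _ _ k])
    show "monomial R L x u \<in> carrier R" using x by blast
    show "c \<otimes> monomial R L x u \<in> monomial_ideal R L x W" if "c \<in> Idl (x ` L)" for c
    proof (rule genideal_colon_subset[OF W _ xL _ that])
      fix a assume "a \<in> x ` L"
      then obtain i where i: "i \<in> L" "a = x i" by auto
      then have "a \<otimes> monomial R L x u = monomial R L x (u(i := Suc (u i)))"
        using monomial_Suc[OF x] by simp
      then show "a \<otimes> monomial R L x u \<in> monomial_ideal R L x W"
        using monomial_mem[OF x(1) up[OF i(1)]] by simp
    qed (use x in blast)
  qed
  then have "chain_bound (ideal_interval R (monomial_ideal R L x W) (monomial_ideal R L x U))
      (card (U - W') * k + k)"
  proof (rule chain_bound_ideal_interval_add[OF monomial_ideal_ideal[OF x(1)] IH])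
    show "monomial_ideal R L x W \<subseteq> monomial_ideal R L x W'"
      by (rule monomial_ideal_mono[OF x(1)]) (auto simp: W'_def)
    show "monomial_ideal R L x W' \<subseteq> monomial_ideal R L x U"
      by (rule monomial_ideal_mono[OF x(1) W'(2)])
  qed (rule monomial_ideal_ideal[OF x(1)])
  then show ?case unfolding card by (simp add: add.commute)
qed

lemma monomial_ideal_power_subset:
  assumes "x \<in> L \<rightarrow> carrier R" "\<And>v. v \<in> V \<Longrightarrow> (\<lambda>i. k * v i) \<in> U"
  shows "monomial_ideal R L (\<lambda>i. x i [^] k) V \<subseteq> monomial_ideal R L x U"
  using assms by (intro monomial_ideal_subsetI) (auto simp: monomial_power intro: monomial_mem)

lemma monomial_ideal_subset_power:
  assumes "x \<in> L \<rightarrow> carrier R" "\<And>u. u \<in> U \<Longrightarrow> \<exists>v\<in>V. \<forall>i\<in>L. k * v i \<le> u i"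
  shows "monomial_ideal R L x U \<subseteq> monomial_ideal R L (\<lambda>i. x i [^] k) V"
proof (rule monomial_ideal_subsetI)
  have y: "(\<lambda>i. x i [^] k) \<in> L \<rightarrow> carrier R" using assms by auto
  then show id: "ideal (monomial_ideal R L (\<lambda>i. x i [^] k) V) R" by blast
  fix u assume "u \<in> U"
  then obtain v where v: "v \<in> V" "\<And>i. i \<in> L \<Longrightarrow> k * v i \<le> u i" using assms(2) by blast
  have "monomial R L x (\<lambda>i. k * v i) \<in> monomial_ideal R L (\<lambda>i. x i [^] k) V"
    using monomial_mem[OF y v(1)] monomial_power[OF assms(1)] by simp
  then show "monomial R L x u \<in> monomial_ideal R L (\<lambda>i. x i [^] k) V"
    by (rule monomial_mono[OF assms(1) id]) (rule v(2))
qed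

text \<open>For \<open>P = {}\<close> and \<open>t = 1\<close> the degree condition reads
  \<open>1 \<le> 0\<close> and never holds; what remains are the exponents with some coordinate at
  least \<open>k\<close>, that is, the multiples of some \<open>k\<close>-th power.\<close>

lemma Idl_powers_eq_monomial_ideal:
  assumes "x \<in> L \<rightarrow> carrier R" "finite L"
  shows "Idl ((\<lambda>i. x i [^] k) ` L) = monomial_ideal R L x (mixed_region L {} 1 k)"
proof (rule subset_antisym)
  have y: "(\<lambda>i. x i [^] k) ` L \<subseteq> carrier R" using assms by auto
  show "Idl ((\<lambda>i. x i [^] k) ` L) \<subseteq> monomial_ideal R L x (mixed_region L {} 1 k)"
  proof (rule genideal_minimal[OF monomial_ideal_ideal[OF assms(1)]], rule image_subsetI)
    fix i assume i: "i \<in> L"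
    have "(\<lambda>j. if j = i then k else 0) \<in> mixed_region L {} 1 k"
      using i unfolding mixed_region_def exponents_def by auto
    then show "x i [^] k \<in> monomial_ideal R L x (mixed_region L {} 1 k)"
      using monomial_mem[OF assms(1)] monomial_single[OF assms i, of k] by metis
  qed
  show "monomial_ideal R L x (mixed_region L {} 1 k) \<subseteq> Idl ((\<lambda>i. x i [^] k) ` L)"
  proof (rule monomial_ideal_subsetI[OF genideal_ideal[OF y]])
    fix u assume "u \<in> mixed_region L {} 1 k"
    then obtain i where i: "i \<in> L" "k \<le> u i" by (auto simp: mixed_region_def)
    have "x i [^] k \<in> Idl ((\<lambda>i. x i [^] k) ` L)"
      by (rule subsetD[OF genideal_self[OF y]]) (rule imageI[OF i(1)])
    then have "monomial R L x (\<lambda>j. if j = i then k else 0) \<in> Idl ((\<lambda>i. x i [^] k) ` L)"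
      unfolding monomial_single[OF assms i(1)] .
    then show "monomial R L x u \<in> Idl ((\<lambda>i. x i [^] k) ` L)"
      by (rule monomial_mono[OF assms(1) genideal_ideal[OF y]]) (use i in simp)
  qed
qed

end

section \<open>Colengths of monomial ideals\<close>

text \<open>Finiteness is recorded by a chain bound because \<open>colength\<close> turns an
  infinite length into an unspecified number.\<close>

definition finite_colength :: "('a, 'b) ring_scheme \<Rightarrow> 'a set \<Rightarrow> bool" where
  "finite_colength R I \<longleftrightarrow> ideal I R \<and> (\<exists>k. chain_bound (ideal_interval R I (carrier R)) k)"

context cring
begin

lemma finite_colengthE:
  assumes "finite_colength R I"
  obtains l where "colength R I = real l" "chain_bound (ideal_interval R I (carrier R)) l" "ideal I R"
  using assms colength_bound unfolding finite_colength_def by metis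

lemma finite_colength_superset:
  assumes "finite_colength R I" "I \<subseteq> N" "ideal N R"
  shows "finite_colength R N" and "colength R N \<le> colength R I"
proof -
  obtain l where l: "colength R I = real l" "chain_bound (ideal_interval R I (carrier R)) l"
    using finite_colengthE[OF assms(1)] by metis
  have N: "chain_bound (ideal_interval R N (carrier R)) l"
    by (rule chain_bound_ideal_interval_subset[OF l(2) assms(2)]) simp
  then show "finite_colength R N" using assms(3) unfolding finite_colength_def by blast
  show "colength R N \<le> colength R I" unfolding l(1) by (rule colength_le[OF assms(3) N])
qed

text \<open>Length adds up along \<open>W\<close>, \<open>U\<close> and the full ring, and the lower
  interval is bounded by the exponent count. With all exponents in the place of \<open>U\<close> the
  same bound gives finiteness.\<close>

lemma colength_monomial_ideal_le:
  assumes x: "x \<in> L \<rightarrow> carrier R" "finite L" and fin: "finite_colength R (Idl (x ` L))"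
    and U: "up_closed L U" "up_closed L W" "W \<subseteq> U" "finite (exponents L - W)" "U \<subseteq> exponents L"
  shows "finite_colength R (monomial_ideal R L x W)"
    and "colength R (monomial_ideal R L x W)
      \<le> colength R (monomial_ideal R L x U) + real (card (U - W)) * colength R (Idl (x ` L))"
proof -
  have id: "ideal (monomial_ideal R L x V) R" for V using x(1) by (rule monomial_ideal_ideal)
  obtain k where k: "colength R (Idl (x ` L)) = real k"
    "chain_bound (ideal_interval R (Idl (x ` L)) (carrier R)) k"
    using finite_colengthE[OF fin] by metis
  have *: "chain_bound (ideal_interval R (monomial_ideal R L x V) (monomial_ideal R L x V'))
      (card (V' - V) * k)" if "up_closed L V" "up_closed L V'" "V \<subseteq> V'" "finite (V' - V)" for V V'
    by (rule chain_bound_monomial_interval[OF x k(2)]) (use that in auto)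
  have fc: "finite_colength R (monomial_ideal R L x V)"
    if "up_closed L V" "V \<subseteq> exponents L" "finite (exponents L - V)" for V
    using *[OF that(1) up_closed_exponents that(2,3)] id
    unfolding finite_colength_def monomial_ideal_exponents[OF x(1)] by blast
  show "finite_colength R (monomial_ideal R L x W)"
    by (rule fc) (use U in auto)
  have "finite (exponents L - U)" by (rule finite_subset[OF _ U(4)]) (use U(3) in auto)
  then obtain l where l: "colength R (monomial_ideal R L x U) = real l"
    "chain_bound (ideal_interval R (monomial_ideal R L x U) (carrier R)) l"
    using finite_colengthE[OF fc[OF U(1,5)]] by metis
  have "finite (U - W)" by (rule finite_subset[OF _ U(4)]) (use U(5) in auto)
  then have "chain_bound (ideal_interval R (monomial_ideal R L x W) (monomial_ideal R L x U))
      (card (U - W) * k)"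
    by (rule *[OF U(2,1,3)])
  then have "chain_bound (ideal_interval R (monomial_ideal R L x W) (carrier R)) (l + card (U - W) * k)"
    using monomial_ideal_mono[OF x(1) U(3)] ideal.Icarr[OF id[of U]]
    by (intro chain_bound_ideal_interval_add[OF id l(2) _ _ _ oneideal]) auto
  from colength_le[OF id this] show "colength R (monomial_ideal R L x W)
      \<le> colength R (monomial_ideal R L x U) + real (card (U - W)) * colength R (Idl (x ` L))"
    unfolding l(1) k(1) by simp
qed

lemma colength_carrier: "colength R (carrier R) = 0"
proof -
  have "chain_bound (ideal_interval R (carrier R) (carrier R)) 0"
    by (intro chain_boundI[where \<rho> = "\<lambda>_. 0"]) (auto simp: ideal_interval_def)
  from colength_le[OF oneideal this] show ?thesis by (simp add: colength_def)
qed

text \<open>The preceding bound with \<open>U\<close> the set of all exponents, whose ideal is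
  \<open>R\<close> itself and has colength zero.\<close>

lemma colength_mixed_region_le:
  assumes x: "x \<in> L \<rightarrow> carrier R" "finite L" and fin: "finite_colength R (Idl (x ` L))"
  shows "finite_colength R (monomial_ideal R L x (mixed_region L P t q))"
    and "colength R (monomial_ideal R L x (mixed_region L P t q))
      \<le> real (simplex_count (card (L \<inter> P)) t * q ^ card (L - P)) * colength R (Idl (x ` L))"
  using colength_monomial_ideal_le[OF x fin up_closed_exponents up_closed_mixed_region
      mixed_region_subset conjunct1[OF card_compl_mixed_region[OF x(2)]] subset_refl, of P t q]
    conjunct2[OF card_compl_mixed_region[OF x(2)], of P t q]
  by (simp_all add: monomial_ideal_exponents[OF x(1)] colength_carrier)

lemma finite_colength_Idl_powers:
  assumes x: "x \<in> L \<rightarrow> carrier R" "finite L" and fin: "finite_colength R (Idl (x ` L))"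
  shows "finite_colength R (Idl ((\<lambda>i. x i [^] (k::nat)) ` L))"
  unfolding Idl_powers_eq_monomial_ideal[OF x] by (rule colength_mixed_region_le(1)[OF assms])

lemma colength_Idl_powers_mono:
  assumes x: "x \<in> L \<rightarrow> carrier R" "finite L" and fin: "finite_colength R (Idl (x ` L))" and "k \<le> l"
  shows "colength R (Idl ((\<lambda>i. x i [^] (k::nat)) ` L)) \<le> colength R (Idl ((\<lambda>i. x i [^] l) ` L))"
  unfolding Idl_powers_eq_monomial_ideal[OF x]
proof (rule finite_colength_superset(2)[OF colength_mixed_region_le(1)[OF x fin]])
  show "monomial_ideal R L x (mixed_region L {} 1 l) \<subseteq> monomial_ideal R L x (mixed_region L {} 1 k)"
  proof (rule monomial_ideal_mono[OF x(1)], rule subsetI)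
    fix u assume "u \<in> mixed_region L {} 1 l"
    then obtain i where "u \<in> exponents L" "i \<in> L" "l \<le> u i" by (auto simp: mixed_region_def)
    then show "u \<in> mixed_region L {} 1 k"
      using le_trans[OF assms(4), of "u i"] by (auto simp: mixed_region_def)
  qed
qed (rule monomial_ideal_ideal[OF x(1)])

lemma power_power_image:
  assumes "x \<in> L \<rightarrow> carrier R"
  shows "(\<lambda>i. (x i [^] (k::nat)) [^] (l::nat)) ` L = (\<lambda>i. x i [^] (k * l)) ` L"
  by (rule image_cong) (use assms in \<open>auto simp: nat_pow_pow Pi_iff\<close>)

text \<open>The counting bound is applied to the family of \<open>k\<close>-th powers: passing to
  their \<open>M\<close>-th powers leaves a box of \<open>M ^ card L\<close> exponents. This is the
  scaling hypothesis of \<open>power_density_exists\<close>.\<close>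

lemma colength_Idl_powers_mult:
  assumes x: "x \<in> L \<rightarrow> carrier R" "finite L" and fin: "finite_colength R (Idl (x ` L))"
  shows "colength R (Idl ((\<lambda>i. x i [^] (k * M)) ` L))
    \<le> real M ^ card L * colength R (Idl ((\<lambda>i. x i [^] (k::nat)) ` L))"
proof -
  have y: "(\<lambda>i. x i [^] k) \<in> L \<rightarrow> carrier R" using x by auto
  have "colength R (monomial_ideal R L (\<lambda>i. x i [^] k) (mixed_region L {} 1 M))
      \<le> real M ^ card L * colength R (Idl ((\<lambda>i. x i [^] k) ` L))"
    using colength_mixed_region_le(2)[OF y x(2) finite_colength_Idl_powers[OF assms], of "{}" 1 M]
    by (simp add: simplex_count_def)
  then show ?thesis
    unfolding Idl_powers_eq_monomial_ideal[OF y x(2), symmetric] power_power_image[OF x(1)] .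
qed

text \<open>Thresholds are rounded up, with \<open>m \<le> k * Suc (m div k)\<close>. The resulting
  region of monomials in the \<open>k\<close>-th powers generates a smaller ideal, whose colength is
  bounded by counting.\<close>

lemma colength_mixed_region_upper:
  assumes x: "x \<in> L \<rightarrow> carrier R" "finite L" and fin: "finite_colength R (Idl (x ` L))" and k: "k > 0"
  shows "colength R (monomial_ideal R L x (mixed_region L P t q))
    \<le> real (simplex_count (card (L \<inter> P)) (Suc (t div k)) * Suc (q div k) ^ card (L - P))
      * colength R (Idl ((\<lambda>i. x i [^] k) ` L))"
proof -
  have y: "(\<lambda>i. x i [^] k) \<in> L \<rightarrow> carrier R" using x by auto
  note fy = finite_colength_Idl_powers[OF x fin, of k]
  have bd: "m \<le> k * n" if "Suc (m div k) \<le> n" for m n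
    using dividend_less_times_div[OF k, of m] mult_le_mono2[OF that, of k] by simp
  have "monomial_ideal R L (\<lambda>i. x i [^] k) (mixed_region L P (Suc (t div k)) (Suc (q div k)))
      \<subseteq> monomial_ideal R L x (mixed_region L P t q)"
    by (rule monomial_ideal_power_subset[OF x(1)])
      (auto simp: mixed_region_def exponents_def sum_distrib_left[symmetric] dest: bd)
  from order_trans[OF finite_colength_superset(2)[OF colength_mixed_region_le(1)[OF y x(2) fy] this
      monomial_ideal_ideal[OF x(1)]] colength_mixed_region_le(2)[OF y x(2) fy]]
  show ?thesis .
qed

text \<open>Rounding exponents down to multiples of \<open>k\<close> enlarges the ideal to one generated by monomials
  in the \<open>x\<^sub>i\<^sup>k\<close>; then its complement in the box of side \<open>k * M\<close> is estimated from above.\<close>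

lemma colength_mixed_region_lower:
  assumes x: "x \<in> L \<rightarrow> carrier R" "finite L" and fin: "finite_colength R (Idl (x ` L))" and k: "k > 0"
    and M: "t div k - card (L \<inter> P) \<le> M" "q div k \<le> M" "0 < M"
  shows "colength R (Idl ((\<lambda>i. x i [^] (k * M)) ` L))
    \<le> colength R (monomial_ideal R L x (mixed_region L P t q))
      + (real M ^ card L - real (simplex_count (card (L \<inter> P)) (t div k - card (L \<inter> P))
          * (q div k) ^ card (L - P))) * colength R (Idl ((\<lambda>i. x i [^] k) ` L))"
proof -
  have y: "(\<lambda>i. x i [^] k) \<in> L \<rightarrow> carrier R" using x by auto
  note fy = finite_colength_Idl_powers[OF x fin, of k]
  let ?r = "card (L \<inter> P)"
  define V where "V = mixed_region L P (t div k - ?r) (q div k)"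
  define B where "B = mixed_region L {} 1 M"
  have fin_B: "finite (exponents L - B)" and card_B: "card (exponents L - B) = M ^ card L"
    using card_compl_mixed_region[OF x(2), of "{}" 1 M] by (simp_all add: B_def simplex_count_def)
  have fin_V: "finite (exponents L - V)"
    and card_V: "card (exponents L - V) = simplex_count ?r (t div k - ?r) * (q div k) ^ card (L - P)"
    using card_compl_mixed_region[OF x(2), of P] by (simp_all add: V_def)
  \<comment> \<open>A coordinate of size at least \<open>M\<close> meets either threshold, by the
    choice of \<open>M\<close>: it bounds the degree below if its index is in \<open>P\<close>, and
    satisfies the other condition if not.\<close>
  have BV: "B \<subseteq> V"
  proof
    fix u assume "u \<in> B"
    then obtain i where u: "u \<in> exponents L" "i \<in> L" "M \<le> u i" by (auto simp: B_def mixed_region_def)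
    have "u i \<le> sum u (L \<inter> P)" if "i \<in> P"
      using that u x(2) by (intro member_le_sum) auto
    moreover have "t div k - ?r \<le> u i" "q div k \<le> u i" using u(3) M by linarith+
    ultimately have "t div k - ?r \<le> sum u (L \<inter> P) \<or> (\<exists>i\<in>L - P. q div k \<le> u i)"
      using u(2) le_trans by (cases "i \<in> P") blast+
    then show "u \<in> V" using u(1) unfolding V_def mixed_region_def by simp
  qed
  have V: "V \<subseteq> exponents L" unfolding V_def by (rule mixed_region_subset)
  have up: "up_closed L V" "up_closed L B" unfolding V_def B_def by (rule up_closed_mixed_region)+
  have "V - B = (exponents L - B) - (exponents L - V)" using V by auto
  then have "card (V - B) = card (exponents L - B) - card (exponents L - V)"
    using BV fin_V by (simp add: card_Diff_subset Diff_mono)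
  moreover have "card (exponents L - V) \<le> card (exponents L - B)"
    using BV fin_B by (intro card_mono) auto
  ultimately have card: "real (card (V - B)) = real (card (exponents L - B)) - real (card (exponents L - V))"
    by (simp add: of_nat_diff)
  have sub: "monomial_ideal R L x (mixed_region L P t q) \<subseteq> monomial_ideal R L (\<lambda>i. x i [^] k) V"
  proof (rule monomial_ideal_subset_power[OF x(1)])
    fix u assume u: "u \<in> mixed_region L P t q"
    have "(\<lambda>i. u i div k) \<in> V"
    proof (cases "t \<le> sum u (L \<inter> P)")
      case True
      \<comment> \<open>Rounding down loses less than one multiple of \<open>k\<close> per variable,
        hence at most \<open>?r\<close> multiples in total; this explains the threshold
        \<open>t div k - ?r\<close>.\<close>
      have "sum u (L \<inter> P) \<le> (\<Sum>i\<in>L \<inter> P. k * Suc (u i div k))"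
        using dividend_less_times_div[OF k] by (intro sum_mono) (simp add: less_imp_le)
      also have "\<dots> = k * ((\<Sum>i\<in>L \<inter> P. u i div k) + ?r)"
        unfolding sum_distrib_left[symmetric] sum_Suc ..
      finally have "t div k \<le> k * ((\<Sum>i\<in>L \<inter> P. u i div k) + ?r) div k"
        using True by (intro div_le_mono) simp
      then have "t div k - ?r \<le> (\<Sum>i\<in>L \<inter> P. u i div k)"
        using k by simp
      then show ?thesis using u by (simp add: V_def mixed_region_def exponents_def)
    next
      case False
      then obtain i where "i \<in> L - P" "q \<le> u i" using u by (auto simp: mixed_region_def)
      then show ?thesis using u div_le_mono[of q "u i" k] by (auto simp: V_def mixed_region_def exponents_def)
    qed
    then show "\<exists>v\<in>V. \<forall>i\<in>L. k * v i \<le> u i"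
      by (rule bexI[rotated]) simp
  qed
  have "colength R (Idl ((\<lambda>i. x i [^] (k * M)) ` L)) = colength R (monomial_ideal R L (\<lambda>i. x i [^] k) B)"
    unfolding B_def Idl_powers_eq_monomial_ideal[OF y x(2), symmetric] power_power_image[OF x(1)] ..
  also have "\<dots> \<le> colength R (monomial_ideal R L (\<lambda>i. x i [^] k) V)
      + real (card (V - B)) * colength R (Idl ((\<lambda>i. x i [^] k) ` L))"
    by (rule colength_monomial_ideal_le(2)[OF y x(2) fy up BV fin_B V])
  also have "colength R (monomial_ideal R L (\<lambda>i. x i [^] k) V)
      \<le> colength R (monomial_ideal R L x (mixed_region L P t q))"
    by (rule finite_colength_superset(2)[OF colength_mixed_region_le(1)[OF x fin] sub monomial_ideal_ideal[OF y]])
  finally show ?thesis unfolding card card_B card_V by simp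
qed

text \<open>The constant is fixed before \<open>P\<close>, \<open>t\<close>, \<open>q\<close> and
  \<open>s\<close>. It depends only on the family \<open>x\<close>, which allows two different
  regions to be compared.\<close>

lemma mixed_region_colength_asymp:
  assumes x: "x \<in> L \<rightarrow> carrier R" "finite L" and fin: "finite_colength R (Idl (x ` L))"
  obtains c where "\<And>P t q s. filterlim q at_top sequentially \<Longrightarrow>
    (\<lambda>n. real (t n) / real (q n)) \<longlonglongrightarrow> s \<Longrightarrow> s > 0 \<Longrightarrow>
    (\<lambda>n. colength R (monomial_ideal R L x (mixed_region L P (t n) (q n))) / real (q n) ^ card L)
      \<longlonglongrightarrow> c * s ^ card (L \<inter> P) / fact (card (L \<inter> P))"
proof -
  define F where "F k = colength R (Idl ((\<lambda>i. x i [^] (k::nat)) ` L))" for k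
  have F: "0 \<le> F n" "m \<le> n \<Longrightarrow> F m \<le> F n" "F (k * M) \<le> real M ^ card L * F k" for m n k M
    unfolding F_def using colength_Idl_powers_mono[OF x fin] colength_Idl_powers_mult[OF x fin]
    by (simp_all add: colength_def)
  have "\<exists>c. (\<lambda>n. F n / real n ^ card L) \<longlonglongrightarrow> c \<and> (\<forall>k>0. c * real k ^ card L \<le> F k)"
    by (rule power_density_exists) (rule F; assumption)+
  then obtain c where c: "(\<lambda>n. F n / real n ^ card L) \<longlonglongrightarrow> c"
    "\<And>k. k > 0 \<Longrightarrow> c * real k ^ card L \<le> F k" by blast
  show thesis
  proof (rule that)
    fix P t q s
    assume q: "filterlim q at_top sequentially" "(\<lambda>n. real (t n) / real (q n)) \<longlonglongrightarrow> s" "s > 0"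
    have "card (L \<inter> P \<union> (L - P)) = card (L \<inter> P) + card (L - P)"
      by (rule card_Un_disjoint) (use x(2) in auto)
    moreover have "L \<inter> P \<union> (L - P) = L" by auto
    ultimately have card: "card L = card (L \<inter> P) + card (L - P)" by simp
    show "(\<lambda>n. colength R (monomial_ideal R L x (mixed_region L P (t n) (q n))) / real (q n) ^ card L)
      \<longlonglongrightarrow> c * s ^ card (L \<inter> P) / fact (card (L \<inter> P))"
      unfolding card
    proof (rule mixed_density_limit[where F = F and
          G = "\<lambda>t q. colength R (monomial_ideal R L x (mixed_region L P t q))", OF _ _ _ _ q])
      show "(\<lambda>n. F n / real n ^ (card (L \<inter> P) + card (L - P))) \<longlonglongrightarrow> c"
        using c(1) unfolding card .
      show "c * real k ^ (card (L \<inter> P) + card (L - P)) \<le> F k" if "k > 0" for k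
        using c(2)[OF that] unfolding card .
    qed (use colength_mixed_region_upper[OF x fin, of _ P] colength_mixed_region_lower[OF x fin, of _ _ P]
        in \<open>simp_all only: F_def card\<close>)
  qed
qed

end

section \<open>Ideal powers and Frobenius powers\<close>

context cring
begin

lemma ideal_prod_subsetI:
  assumes "ideal N R" "\<And>a b. a \<in> A \<Longrightarrow> b \<in> B \<Longrightarrow> a \<otimes> b \<in> N"
  shows "A \<cdot> B \<subseteq> N"
proof
  interpret N: ideal N R by fact
  fix z assume "z \<in> A \<cdot> B"
  then show "z \<in> N" by induct (use assms(2) N.a_closed in auto)
qed

lemma ideal_power_0: "ideal_power R A 0 = carrier R"
  by (simp add: nat_pow_def ideals_set_def)

lemma ideal_power_Suc: "ideal_power R A (Suc n) = ideal_power R A n \<cdot> A"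
  by (simp add: nat_pow_def ideals_set_def)

lemma ideal_power_ideal: "ideal A R \<Longrightarrow> ideal (ideal_power R A n) R"
proof (induction n)
  case 0
  show ?case unfolding ideal_power_0 by (rule oneideal)
next
  case (Suc n)
  then show ?case unfolding ideal_power_Suc by (intro ideal_prod_is_ideal)
qed

text \<open>Multiplication by a generator raises the degree in \<open>P\<close> by one; conversely,
  a monomial of positive degree in \<open>P\<close> releases a variable from \<open>P\<close>. For
  \<open>P = {}\<close> and positive \<open>n\<close> both sides are the zero ideal.\<close>

lemma ideal_power_Idl_eq_monomial_ideal:
  assumes x: "x \<in> L \<rightarrow> carrier R" "finite L" and P: "P \<subseteq> L"
  shows "ideal_power R (Idl (x ` P)) n = monomial_ideal R L x {u \<in> exponents L. n \<le> sum u P}"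
proof (rule subset_antisym)
  have xP: "x ` P \<subseteq> carrier R" using x(1) P by auto
  let ?K = "\<lambda>n. monomial_ideal R L x {u \<in> exponents L. n \<le> sum u P}"
  have K: "ideal (?K n) R" for n using x(1) by (rule monomial_ideal_ideal)
  have pow: "ideal (ideal_power R (Idl (x ` P)) n) R" for n
    by (rule ideal_power_ideal[OF genideal_ideal[OF xP]])
  \<comment> \<open>The colon argument is used twice: it reduces \<open>b\<close> to a variable and
    then \<open>a\<close> to a monomial.\<close>
  have step: "a \<otimes> b \<in> ?K (Suc n)" if a: "a \<in> ?K n" and b: "b \<in> Idl (x ` P)" for a b n
  proof -
    have aR: "a \<in> carrier R" using a by (rule ideal.Icarr[OF K])
    have bR: "b \<in> carrier R" using b by (rule ideal.Icarr[OF genideal_ideal[OF xP]])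
    have "b \<otimes> a \<in> ?K (Suc n)"
    proof (rule genideal_colon_subset[OF K aR xP _ b])
      fix y assume "y \<in> x ` P"
      then obtain i where i: "i \<in> P" "y = x i" by (elim imageE)
      have iL: "i \<in> L" using i P by auto
      have yR: "y \<in> carrier R" using i xP by auto
      have mR: "monomial R L x ` {u \<in> exponents L. n \<le> sum u P} \<subseteq> carrier R"
        using x(1) by auto
      have "a \<otimes> y \<in> ?K (Suc n)"
      proof (rule genideal_colon_subset[OF K yR mR _ a[unfolded monomial_ideal_def]])
        fix w assume "w \<in> monomial R L x ` {u \<in> exponents L. n \<le> sum u P}"
        then obtain u where u: "u \<in> exponents L" "n \<le> sum u P" "w = monomial R L x u"
          by (elim imageE CollectE conjE)
        have "sum u P < sum (u(i := Suc (u i))) P"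
          by (rule sum_strict_mono_ex1) (use i finite_subset[OF P x(2)] in auto)
        then have "u(i := Suc (u i)) \<in> {u \<in> exponents L. Suc n \<le> sum u P}"
          using u(1,2) iL by (simp add: exponents_def del: fun_upd_apply) auto
        from monomial_mem[OF x(1) this] show "w \<otimes> y \<in> ?K (Suc n)"
          unfolding monomial_Suc[OF x iL] i(2) u(3)
          using m_comm[OF yR monomial_closed[OF x(1), of u]] i(2) by simp
      qed
      then show "y \<otimes> a \<in> ?K (Suc n)" using m_comm[OF aR yR] by simp
    qed
    then show ?thesis using m_comm[OF aR bR] by simp
  qed
  show "ideal_power R (Idl (x ` P)) n \<subseteq> ?K n"
  proof (induction n)
    case 0
    have "{u \<in> exponents L. 0 \<le> sum u P} = exponents L" by auto
    then show ?case unfolding ideal_power_0 by (simp add: monomial_ideal_exponents[OF x(1)])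
  next
    case (Suc n)
    show ?case unfolding ideal_power_Suc
      by (rule ideal_prod_subsetI[OF K step[OF subsetD[OF Suc.IH]]])
  qed
  have mem: "monomial R L x u \<in> ideal_power R (Idl (x ` P)) n" if "u \<in> exponents L" "n \<le> sum u P" for u n
    using that
  proof (induction n arbitrary: u)
    case 0
    show ?case unfolding ideal_power_0 by (rule monomial_closed[OF x(1)])
  next
    case (Suc n)
    then have "sum u P \<noteq> 0" by linarith
    then obtain i where i: "i \<in> P" "u i \<noteq> 0" by (rule sum.not_neutral_contains_not_neutral)
    have iL: "i \<in> L" using i P by auto
    define v where "v = u(i := u i - 1)"
    have u: "u = v(i := Suc (v i))" using i by (simp add: v_def fun_eq_iff)
    have "sum u P \<le> sum v P + 1"
    proof -
      have "sum u P = u i + sum u (P - {i})"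
        by (rule sum.remove) (use i finite_subset[OF P x(2)] in auto)
      moreover have "sum v P = v i + sum v (P - {i})"
        by (rule sum.remove) (use i finite_subset[OF P x(2)] in auto)
      moreover have "sum u (P - {i}) = sum v (P - {i})"
        by (rule sum.cong) (auto simp: v_def)
      moreover have "u i = v i + 1" using i(2) by (simp add: v_def)
      ultimately show ?thesis by linarith
    qed
    then have "n \<le> sum v P" using Suc.prems(2) by linarith
    moreover have "v \<in> exponents L" using Suc.prems(1) by (simp add: v_def exponents_def)
    ultimately have "monomial R L x v \<in> ideal_power R (Idl (x ` P)) n"
      by (intro Suc.IH)
    moreover have "x i \<in> Idl (x ` P)"
      by (rule subsetD[OF genideal_self[OF xP]]) (rule imageI[OF i(1)])
    ultimately have "monomial R L x v \<otimes> x i \<in> ideal_power R (Idl (x ` P)) (Suc n)"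
      unfolding ideal_power_Suc by (rule ideal_prod.prod)
    moreover have "x i \<in> carrier R" using x(1) iL by auto
    then have "monomial R L x (v(i := Suc (v i))) = monomial R L x v \<otimes> x i"
      unfolding monomial_Suc[OF x iL] by (rule m_comm[OF _ monomial_closed[OF x(1)]])
    ultimately show ?case unfolding u[symmetric] by (simp only:)
  qed
  show "?K n \<subseteq> ideal_power R (Idl (x ` P)) n"
    by (rule monomial_ideal_subsetI[OF pow], rule mem) simp_all
qed

text \<open>Here \<open>q\<close> is any exponent, and powers are taken of the generators only; the
  characteristic enters separately, through \<open>frobenius_power_Idl\<close>.\<close>

lemma ideal_power_add_powers_eq_monomial_ideal:
  assumes x: "x \<in> L \<rightarrow> carrier R" "finite L" and P: "P \<subseteq> L"
  shows "ideal_power R (Idl (x ` P)) t <+>\<^bsub>R\<^esub> Idl ((\<lambda>i. x i [^] (q::nat)) ` (L - P))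
    = monomial_ideal R L x (mixed_region L P t q)"
proof -
  have LP: "L \<inter> P = P" using P by auto
  have y: "(\<lambda>i. x i [^] q) ` (L - P) \<subseteq> carrier R" using x(1) by auto
  let ?M = "monomial_ideal R L x (mixed_region L P t q)"
  let ?K = "monomial_ideal R L x {u \<in> exponents L. t \<le> sum u P}"
  let ?Y = "Idl ((\<lambda>i. x i [^] q) ` (L - P))"
  have M: "ideal ?M R" and K: "ideal ?K R" by (rule monomial_ideal_ideal[OF x(1)])+
  have S: "ideal (?K <+>\<^bsub>R\<^esub> ?Y) R" by (rule add_ideals[OF K genideal_ideal[OF y]])
  have sub: "?K \<subseteq> ?K <+>\<^bsub>R\<^esub> ?Y \<and> ?Y \<subseteq> ?K <+>\<^bsub>R\<^esub> ?Y"
    using set_add_ideal_subset_iff[OF K genideal_ideal[OF y] S] by simp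
  have "?K <+>\<^bsub>R\<^esub> ?Y \<subseteq> ?M"
    unfolding set_add_ideal_subset_iff[OF K genideal_ideal[OF y] M]
  proof
    show "?K \<subseteq> ?M" by (rule monomial_ideal_mono[OF x(1)]) (auto simp: mixed_region_def LP)
    show "?Y \<subseteq> ?M"
    proof (rule genideal_minimal[OF M], rule image_subsetI)
      fix i assume i: "i \<in> L - P"
      then have iL: "i \<in> L" by simp
      have "(\<lambda>j. if j = i then q else 0) \<in> mixed_region L P t q"
        using i unfolding mixed_region_def exponents_def by auto
      from monomial_mem[OF x(1) this] show "x i [^] q \<in> ?M"
        unfolding monomial_single[OF x iL] .
    qed
  qed
  moreover have "?M \<subseteq> ?K <+>\<^bsub>R\<^esub> ?Y"
  proof (rule monomial_ideal_subsetI[OF S])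
    fix u assume "u \<in> mixed_region L P t q"
    then have "u \<in> exponents L \<and> t \<le> sum u P \<or> (\<exists>i\<in>L - P. q \<le> u i)"
      unfolding mixed_region_def LP by auto
    then show "monomial R L x u \<in> ?K <+>\<^bsub>R\<^esub> ?Y"
    proof (elim disjE bexE)
      assume "u \<in> exponents L \<and> t \<le> sum u P"
      then have "monomial R L x u \<in> ?K" by (intro monomial_mem[OF x(1)]) simp
      then show ?thesis using sub by auto
    next
      fix i assume i: "i \<in> L - P" "q \<le> u i"
      then have iL: "i \<in> L" by simp
      have "x i [^] q \<in> ?Y"
        by (rule subsetD[OF genideal_self[OF y]]) (rule imageI[OF i(1)])
      then have "monomial R L x (\<lambda>j. if j = i then q else 0) \<in> ?K <+>\<^bsub>R\<^esub> ?Y"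
        unfolding monomial_single[OF x iL] using sub by auto
      then show ?thesis
        by (rule monomial_mono[OF x(1) S]) (use i in simp)
    qed
  qed
  ultimately show ?thesis
    unfolding ideal_power_Idl_eq_monomial_ideal[OF x P] by (rule subset_antisym)
qed

lemma Idl_add_Idl:
  assumes "S \<subseteq> carrier R" "T \<subseteq> carrier R"
  shows "Idl S <+>\<^bsub>R\<^esub> Idl T = Idl (S \<union> T)"
proof (rule subset_antisym)
  have ST: "S \<union> T \<subseteq> carrier R" using assms by simp
  note S = genideal_ideal[OF assms(1)] and T = genideal_ideal[OF assms(2)]
  have id: "ideal (Idl S <+>\<^bsub>R\<^esub> Idl T) R" by (rule add_ideals[OF S T])
  have "Idl S \<subseteq> Idl S <+>\<^bsub>R\<^esub> Idl T \<and> Idl T \<subseteq> Idl S <+>\<^bsub>R\<^esub> Idl T"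
    using set_add_ideal_subset_iff[OF S T id] by simp
  then show "Idl (S \<union> T) \<subseteq> Idl S <+>\<^bsub>R\<^esub> Idl T"
    using genideal_self[OF assms(1)] genideal_self[OF assms(2)]
    by (intro genideal_minimal[OF id] Un_least) (metis subset_trans)+
  show "Idl S <+>\<^bsub>R\<^esub> Idl T \<subseteq> Idl (S \<union> T)"
    unfolding set_add_ideal_subset_iff[OF S T genideal_ideal[OF ST]]
    using genideal_self[OF ST] by (intro conjI genideal_minimal[OF genideal_ideal[OF ST]]) simp_all
qed

section \<open>The Frobenius map and generators of Frobenius powers\<close>

lemma binomial_expansion:
  assumes [simp]: "a \<in> carrier R" "b \<in> carrier R"
  shows "(a \<oplus> b) [^] (n::nat) = (\<Oplus>k\<in>{..n}. [(n choose k)] \<cdot>\<^bsub>R\<^esub> (a [^] k \<otimes> b [^] (n - k)))"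
proof (induction n)
  case 0
  then show ?case by simp
next
  case (Suc n)
  define f where "f k = [(n choose k)] \<cdot>\<^bsub>R\<^esub> (a [^] k \<otimes> b [^] (n - k))" for k
  define g where "g k = [(n choose k)] \<cdot>\<^bsub>R\<^esub> (a [^] k \<otimes> b [^] (Suc n - k))" for k
  have f [simp]: "f k \<in> carrier R" for k by (simp add: f_def)
  have g [simp]: "g k \<in> carrier R" for k by (simp add: g_def)
  have fin: "finite {..n}" and fF: "f \<in> {..n} \<rightarrow> carrier R" by simp_all
  have "(\<Oplus>k\<in>{..n}. f k \<otimes> b) = (\<Oplus>k\<in>{..n}. g k)"
    by (rule finsum_cong') (auto simp: f_def g_def add_pow_ldistr m_assoc Suc_diff_le)
  \<comment> \<open>The added term carries the coefficient \<open>n choose Suc n\<close>, which is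
    zero; the longer sum can be shifted by one and combined by Pascal's rule.\<close>
  also have "\<dots> = (\<Oplus>k\<in>{..Suc n}. g k)"
    by (simp add: g_def binomial_eq_0)
  also have "\<dots> = (\<Oplus>k\<in>{..n}. g (Suc k)) \<oplus> g 0"
    by (rule finsum_Suc2) simp
  finally have fb: "(\<Oplus>k\<in>{..n}. f k \<otimes> b) = (\<Oplus>k\<in>{..n}. g (Suc k)) \<oplus> g 0" .
  have fg: "f k \<otimes> a \<oplus> g (Suc k) = [(Suc n choose Suc k)] \<cdot>\<^bsub>R\<^esub> (a [^] Suc k \<otimes> b [^] (Suc n - Suc k))" for k
    by (simp add: f_def g_def add_pow_ldistr add_pow_rdistr m_ac add.nat_pow_mult)
  have "(a \<oplus> b) [^] Suc n = (\<Oplus>k\<in>{..n}. f k) \<otimes> a \<oplus> (\<Oplus>k\<in>{..n}. f k) \<otimes> b"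
    using Suc.IH by (simp add: f_def r_distr)
  also have "\<dots> = (\<Oplus>k\<in>{..n}. f k \<otimes> a) \<oplus> ((\<Oplus>k\<in>{..n}. g (Suc k)) \<oplus> g 0)"
    unfolding fb[symmetric] by (simp add: finsum_ldistr[OF fin _ fF])
  also have "\<dots> = (\<Oplus>k\<in>{..n}. f k \<otimes> a \<oplus> g (Suc k)) \<oplus> g 0"
    by (simp add: finsum_addf a_assoc Pi_def)
  also have "\<dots> = (\<Oplus>k\<in>{..Suc n}. [(Suc n choose k)] \<cdot>\<^bsub>R\<^esub> (a [^] k \<otimes> b [^] (Suc n - k)))"
    unfolding fg by (subst finsum_Suc2) (simp_all add: g_def)
  finally show ?case .
qed

lemma add_pow_eq_zero_of_char:
  assumes "has_char R p" "p dvd n" "a \<in> carrier R"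
  shows "[n] \<cdot>\<^bsub>R\<^esub> a = \<zero>"
proof -
  have "[n] \<cdot>\<^bsub>R\<^esub> \<one> = \<zero>" using assms(1,2) unfolding has_char_def by simp
  then show ?thesis using add_pow_ldistr[of \<one> a n] assms(3) by simp
qed

lemma frobenius_add:
  assumes "has_char R p" "Factorial_Ring.prime p" and [simp]: "a \<in> carrier R" "b \<in> carrier R"
  shows "(a \<oplus> b) [^] p = a [^] p \<oplus> b [^] p"
proof -
  obtain n where n: "p = Suc n" using prime_gt_0_nat[OF assms(2)] by (metis gr0_conv_Suc)
  define T where "T k = [(p choose k)] \<cdot>\<^bsub>R\<^esub> (a [^] k \<otimes> b [^] (p - k))" for k
  have T [simp]: "T k \<in> carrier R" for k by (simp add: T_def)
  have zero: "T k = \<zero>" if "k \<in> {0<..<p}" for k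
    unfolding T_def
    by (rule add_pow_eq_zero_of_char[OF assms(1)])
      (use that dvd_choose_prime[of k p] assms(2) in auto)
  have "(a \<oplus> b) [^] p = (\<Oplus>k\<in>{..Suc n}. T k)"
    using binomial_expansion[of a b p] by (simp only: T_def n assms(3,4))
  also have "\<dots> = (\<Oplus>k\<in>{0, p}. T k)"
    by (rule add.finprod_mono_neutral_cong_right) (use zero n in auto)
  also have "\<dots> = a [^] p \<oplus> b [^] p"
    using n by (simp add: T_def a_comm)
  finally show ?thesis .
qed

lemma frobenius_power_add:
  assumes "has_char R p" "Factorial_Ring.prime p" "a \<in> carrier R" "b \<in> carrier R"
  shows "(a \<oplus> b) [^] (p ^ n) = a [^] (p ^ n) \<oplus> b [^] (p ^ n)"
proof (induction n)
  case (Suc n)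
  have "c [^] (p ^ Suc n) = (c [^] (p ^ n)) [^] p" if "c \<in> carrier R" for c
    using that by (simp add: nat_pow_pow mult.commute)
  then show ?case using Suc.IH frobenius_add[OF assms(1,2)] assms(3,4) by simp
qed (use assms in simp)

text \<open>Since \<open>a \<mapsto> a [^] (p ^ n)\<close> is additive, the elements whose power
  lies in the ideal on the right form an ideal. It contains \<open>S\<close>, hence all of
  \<open>Idl S\<close>.\<close>

lemma frobenius_power_Idl:
  assumes "has_char R p" "Factorial_Ring.prime p" "S \<subseteq> carrier R"
  shows "frobenius_power R (Idl S) (p ^ n) = Idl ((\<lambda>a. a [^] (p ^ n)) ` S)"
proof (rule subset_antisym)
  have S': "(\<lambda>a. a [^] (p ^ n)) ` S \<subseteq> carrier R" using assms(3) by auto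
  have I: "ideal (Idl S) R" by (rule genideal_ideal[OF assms(3)])
  interpret N: ideal "Idl ((\<lambda>a. a [^] (p ^ n)) ` S)" R by (rule genideal_ideal[OF S'])
  let ?N = "Idl ((\<lambda>a. a [^] (p ^ n)) ` S)"
  let ?J = "{a \<in> carrier R. a [^] (p ^ n) \<in> ?N}"
  have p0: "p ^ n \<noteq> 0" using prime_gt_0_nat[OF assms(2)] by simp
  have neg: "\<ominus> a \<in> ?J" if "a \<in> ?J" for a
  proof -
    have a: "a \<in> carrier R" "a [^] (p ^ n) \<in> ?N" using that by simp_all
    \<comment> \<open>Factoring out \<open>\<ominus> \<one>\<close> settles closure under negation
      whatever the parity of \<open>p ^ n\<close>.\<close>
    have "\<ominus> a = \<ominus> \<one> \<otimes> a" using a by (simp add: l_minus)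
    then have "(\<ominus> a) [^] (p ^ n) = (\<ominus> \<one>) [^] (p ^ n) \<otimes> a [^] (p ^ n)"
      using a by (simp add: nat_pow_distrib)
    then show ?thesis using a N.I_l_closed[OF a(2)] by simp
  qed
  have "ideal ?J R"
  proof (rule idealI)
    show "subgroup ?J (add_monoid R)"
    proof (rule add.subgroupI)
      have "\<zero> [^] (p ^ n) = \<zero>" using p0 by (rule nat_pow_zero)
      then have "\<zero> \<in> ?J" using N.zero_closed by (simp only: mem_Collect_eq zero_closed)
      then show "?J \<noteq> {}" by (simp only: ex_in_conv[symmetric]) (rule exI)
      show "\<ominus> a \<in> ?J" if "a \<in> ?J" for a by (rule neg[OF that])
      show "a \<oplus> b \<in> ?J" if "a \<in> ?J" "b \<in> ?J" for a b
        using that frobenius_power_add[OF assms(1,2)] N.a_closed by simp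
    qed simp
    show "b \<otimes> a \<in> ?J" if "a \<in> ?J" "b \<in> carrier R" for a b
      using that N.I_l_closed by (simp add: nat_pow_distrib)
    show "a \<otimes> b \<in> ?J" if "a \<in> ?J" "b \<in> carrier R" for a b
      using that N.I_r_closed by (simp add: nat_pow_distrib)
  qed (rule ring_axioms)
  then have "Idl S \<subseteq> ?J"
    using genideal_self[OF S'] assms(3) by (intro genideal_minimal) auto
  then show "frobenius_power R (Idl S) (p ^ n) \<subseteq> ?N"
    unfolding frobenius_power_def by (intro genideal_minimal N.ideal_axioms) auto
  have F: "{a [^] (p ^ n) | a. a \<in> Idl S} \<subseteq> carrier R" using ideal.Icarr[OF I] by auto
  show "?N \<subseteq> frobenius_power R (Idl S) (p ^ n)"
    unfolding frobenius_power_def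
  proof (rule genideal_minimal[OF genideal_ideal[OF F]], rule image_subsetI)
    fix a assume "a \<in> S"
    then have "a \<in> Idl S" using genideal_self[OF assms(3)] by auto
    then show "a [^] (p ^ n) \<in> Idl {a [^] (p ^ n) | a. a \<in> Idl S}"
      by (intro subsetD[OF genideal_self[OF F]]) auto
  qed
qed

section \<open>Finite colength of the parameter ideal\<close>

lemma finite_colength_maximalideal:
  assumes "maximalideal m R"
  shows "finite_colength R m"
proof -
  have "chain_bound (ideal_interval R m (carrier R)) 1"
  proof (rule chain_boundI[where \<rho> = "\<lambda>N. if N = m then 0 else 1"])
    fix V Y assume "V \<in> ideal_interval R m (carrier R)" "Y \<in> ideal_interval R m (carrier R)" "V < Y"
    moreover from this have "V = m \<or> V = carrier R"
      using maximalideal.I_maximal[OF assms, of V] by (auto simp: ideal_interval_def)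
    ultimately show "(if V = m then 0 else 1) < (if Y = m then 0 else (1::nat))"
      by (auto simp: ideal_interval_def)
  qed simp
  then show ?thesis using maximalideal.axioms(1)[OF assms] unfolding finite_colength_def by blast
qed

text \<open>By noetherianity \<open>m\<close> has finitely many generators, and a common
  \<open>k\<close>-th power of them lies in \<open>Q\<close>. The ideal of these powers has finite
  colength by the monomial count, starting from \<open>R/m\<close>.\<close>

lemma finite_colength_of_radical:
  assumes "noetherian_ring R" "maximalideal m R" "ideal Q R" "ideal_radical R Q = m"
  shows "finite_colength R Q"
proof -
  have m: "ideal m R" using maximalideal.axioms(1)[OF assms(2)] .
  obtain S where S: "S \<subseteq> carrier R" "finite S" "m = Idl S"
    using noetherian_ring.finetely_gen[OF assms(1) m] by blast
  interpret Q: ideal Q R by fact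
  have "\<exists>n::nat. g [^] n \<in> Q" if "g \<in> S" for g
    using that genideal_self[OF S(1)] S(3) assms(4) unfolding ideal_radical_def by auto
  then obtain e :: "'a \<Rightarrow> nat" where e: "\<And>g. g \<in> S \<Longrightarrow> g [^] e g \<in> Q" by metis
  define k where "k = sum e S"
  have k: "g [^] k \<in> Q" if g: "g \<in> S" for g
  proof -
    have "e g \<le> k" unfolding k_def using S(2) g by (intro member_le_sum) auto
    then have "g [^] k = g [^] (k - e g) \<otimes> g [^] e g"
      using S(1) g by (auto simp: nat_pow_mult)
    then show ?thesis using Q.I_l_closed[OF e[OF g]] S(1) g by auto
  qed
  \<comment> \<open>The generators are indexed by themselves, so that the results on families of
    variables apply.\<close>
  have x: "(\<lambda>g. g) \<in> S \<rightarrow> carrier R" using S(1) by auto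
  have "finite_colength R (Idl ((\<lambda>g. g) ` S))"
    using finite_colength_maximalideal[OF assms(2)] S(3) by simp
  from finite_colength_Idl_powers[OF x S(2) this]
  have "finite_colength R (Idl ((\<lambda>g. g [^] k) ` S))" .
  moreover have "Idl ((\<lambda>g. g [^] k) ` S) \<subseteq> Q"
    by (rule genideal_minimal[OF assms(3)], rule image_subsetI, rule k)
  ultimately show ?thesis by (rule finite_colength_superset(1)[OF _ _ assms(3)])
qed

end

text \<open>If \<open>p\<close> divides \<open>a * b\<close>, the product of the corresponding
  multiples of \<open>\<one>\<close> vanishes, and so does one factor. The case \<open>p = 1\<close>
  would force \<open>\<one> = \<zero>\<close>.\<close>

lemma (in "domain") prime_of_has_char:
  assumes "has_char R p" "p > 0"
  shows "Factorial_Ring.prime p"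
proof (rule prime_natI)
  have zero_iff: "[n] \<cdot>\<^bsub>R\<^esub> \<one> = \<zero> \<longleftrightarrow> p dvd n" for n :: nat
    using assms(1) unfolding has_char_def by blast
  have "p \<noteq> 1" using zero_iff[of 1] one_not_zero by auto
  then show "p \<ge> 2" using assms(2) by linarith
  fix a b assume "p dvd a * b"
  then have "[(a * b)] \<cdot>\<^bsub>R\<^esub> \<one> = \<zero>" using zero_iff by simp
  moreover have "[(a * b)] \<cdot>\<^bsub>R\<^esub> \<one> = ([a] \<cdot>\<^bsub>R\<^esub> \<one>) \<otimes> ([b] \<cdot>\<^bsub>R\<^esub> \<one>)"
    by (simp add: add_pow_ldistr add.nat_pow_pow mult.commute)
  ultimately show "p dvd a \<or> p dvd b" using integral zero_iff by auto
qed

section \<open>Multiplicity and h-function from one asymptotic constant\<close>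

theorem proposition8p12:
  fixes R :: "('a, 'b) ring_scheme" (structure)
    and m I J :: "'a set" and x :: "nat \<Rightarrow> 'a" and p d r :: nat and s :: real
  assumes "noetherian_domain R" and "local_ring R m"
    and "has_char R p" and "p > 0" and "F_finite R p"
    and "krull_dim R = enat d" and "system_of_parameters R m d x"
    and "r \<le> d"
    and "I = Idl (x ` {1..r})" and "J = Idl (x ` {r+1..d})"
    and "s > 0"
  shows "h_function R p I J s = hilbert_samuel_mult R (I <+> J) / fact r * s ^ r"
proof -
  interpret noetherian_domain R by fact
  let ?L = "{1..d}" and ?P = "{1..r}"
  have p: "Factorial_Ring.prime p" by (rule prime_of_has_char[OF assms(3,4)])
  have max: "maximalideal m R" using assms(2) unfolding local_ring_def by auto
  have xm: "x ` ?L \<subseteq> m" and rad: "ideal_radical R (Idl (x ` ?L)) = m"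
    using assms(7) unfolding system_of_parameters_def by simp_all
  have xc: "x ` ?L \<subseteq> carrier R"
    using xm ideal.Icarr[OF maximalideal.axioms(1)[OF max]] by auto
  then have x: "x \<in> ?L \<rightarrow> carrier R" "finite ?L" by auto
  have P: "?P \<subseteq> ?L" "?L - ?P = {r+1..d}" "?L \<inter> ?P = ?P" using assms(8) by auto
  have "finite_colength R (Idl (x ` ?L))"
    by (rule finite_colength_of_radical[OF noetherian_ring_axioms max genideal_ideal[OF xc] rad])
  from mixed_region_colength_asymp[OF x this] obtain c where c: "\<And>P t q s. filterlim q at_top sequentially \<Longrightarrow>
    (\<lambda>n. real (t n) / real (q n)) \<longlonglongrightarrow> s \<Longrightarrow> s > 0 \<Longrightarrow>
    (\<lambda>n. colength R (monomial_ideal R ?L x (mixed_region ?L P (t n) (q n))) / real (q n) ^ card ?L)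
      \<longlonglongrightarrow> c * s ^ card (?L \<inter> P) / fact (card (?L \<inter> P))"
    by this (rule that)
  have "x ` ?P \<subseteq> carrier R" "x ` {r+1..d} \<subseteq> carrier R" using xc assms(8) by auto
  then have "I <+> J = Idl (x ` ?P \<union> x ` {r+1..d})"
    unfolding assms(9,10) by (rule Idl_add_Idl)
  also have "x ` ?P \<union> x ` {r+1..d} = x ` ?L"
    unfolding image_Un[symmetric] P(2)[symmetric] using P(1) by (simp add: Un_absorb1)
  finally have IJ: "I <+> J = Idl (x ` ?L)" .
  \<comment> \<open>With \<open>P = L\<close> no variable is subject to the condition on
    \<open>q\<close>; the sequence \<open>q n = n\<close> only normalises, and the ratio
    \<open>s\<close> is \<open>1\<close>.\<close>
  have "ideal_power R (I <+> J) n = monomial_ideal R ?L x (mixed_region ?L ?L n n)" for n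
    unfolding IJ ideal_power_Idl_eq_monomial_ideal[OF x subset_refl]
    by (simp add: mixed_region_def)
  moreover have "(\<lambda>n. real n / real n) \<longlonglongrightarrow> 1"
    by (rule tendsto_eventually) (auto intro: eventually_mono[OF eventually_gt_at_top[of 0]])
  ultimately have "(\<lambda>n. colength R (ideal_power R (I <+> J) n) / real n ^ d) \<longlonglongrightarrow> c / fact d"
    using c[OF filterlim_ident, of "\<lambda>n. n" 1 ?L] by simp
  then have "(\<lambda>n. fact d * (colength R (ideal_power R (I <+> J) n) / real n ^ d)) \<longlonglongrightarrow> fact d * (c / fact d)"
    by (rule tendsto_mult_left)
  then have mult: "hilbert_samuel_mult R (I <+> J) = c"
    unfolding hilbert_samuel_mult_def Let_def assms(6) by (simp add: limI)
  define t where "t n = nat \<lceil>s * real (p ^ n)\<rceil>" for n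
  have p1: "1 < p" using prime_gt_1_nat[OF p] .
  have q: "filterlim (\<lambda>n. p ^ n) at_top sequentially"
    by (rule filterlim_at_top_mono[OF filterlim_ident])
      (use p1 in \<open>auto intro: always_eventually less_imp_le[OF power_gt_expt]\<close>)
  have t: "(\<lambda>n. real (t n) / real (p ^ n)) \<longlonglongrightarrow> s"
  proof (rule tendsto_sandwich)
    have q0: "0 < real (p ^ n)" for n using p1 by simp
    \<comment> \<open>As \<open>s\<close> is positive, \<open>nat\<close> does not truncate, and the
      ceiling adds at most one; after division by \<open>p ^ n\<close> this error vanishes.\<close>
    have b: "s * real (p ^ n) \<le> real (t n)" "real (t n) \<le> s * real (p ^ n) + 1" for n
    proof -
      have "0 \<le> s * real (p ^ n)" using assms(11) by simp
      then have "real (t n) = of_int \<lceil>s * real (p ^ n)\<rceil>" unfolding t_def by simp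
      then show "s * real (p ^ n) \<le> real (t n)" "real (t n) \<le> s * real (p ^ n) + 1"
        by linarith+
    qed
    show "\<forall>\<^sub>F n in sequentially. s \<le> real (t n) / real (p ^ n)"
      using b(1) q0 by (intro always_eventually allI) (simp only: pos_le_divide_eq)
    show "\<forall>\<^sub>F n in sequentially. real (t n) / real (p ^ n) \<le> s + 1 / real (p ^ n)"
    proof (intro always_eventually allI)
      fix n
      have "real (t n) / real (p ^ n) \<le> (s * real (p ^ n) + 1) / real (p ^ n)"
        by (rule divide_right_mono[OF b(2)]) simp
      then show "real (t n) / real (p ^ n) \<le> s + 1 / real (p ^ n)"
        using q0[of n] by (simp only: add_divide_distrib nonzero_mult_div_cancel_right less_imp_neq[symmetric] not_False_eq_True)
    qed
    have "(\<lambda>n. 1 / real (p ^ n)) \<longlonglongrightarrow> 0"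
      by (rule real_tendsto_divide_at_top[OF tendsto_const
            filterlim_compose[OF filterlim_real_sequentially q]])
    from tendsto_add[OF tendsto_const this, of s]
    show "(\<lambda>n. s + 1 / real (p ^ n)) \<longlonglongrightarrow> s" by simp
  qed simp
  have xJ: "x ` {r+1..d} \<subseteq> carrier R" using xc by auto
  have "ideal_power R I (t n) <+> frobenius_power R J (p ^ n)
      = monomial_ideal R ?L x (mixed_region ?L ?P (t n) (p ^ n))" for n
    using ideal_power_add_powers_eq_monomial_ideal[OF x P(1), of "t n" "p ^ n"]
    unfolding assms(9,10) frobenius_power_Idl[OF assms(3) p xJ] P(2) image_image .
  \<comment> \<open>The same \<open>c\<close>, already identified with the multiplicity, is now used
    with \<open>P = {1..r}\<close>, whose \<open>r\<close> variables give the factor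
    \<open>s ^ r / fact r\<close>.\<close>
  then have "(\<lambda>n. colength R (ideal_power R I (t n) <+> frobenius_power R J (p ^ n))
      / real (p ^ n) ^ d) \<longlonglongrightarrow> c * s ^ r / fact r"
    using c[OF q t assms(11), of ?P] unfolding P(3) by simp
  then have "h_function R p I J s = c * s ^ r / fact r"
    unfolding h_function_def Let_def assms(6) t_def by (simp add: limI power_mult)
  then show ?thesis unfolding mult by simp
qed

end
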